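(* Let $K$ be a finite simplicial complex, $p\ge0$ a homology degree, $\mathcal{M}$ a smooth finite-dimensional manifold without boundary, $r\in\mathbb{N}$, and $F:\mathcal{M}\to\mathbb{R}^K$ a map all of whose values are filter functions; let $B_p:=\mathrm{Dgm}_p\circ F:\mathcal{M}\to Bar$. Suppose $\mathcal{S}_{\mathcal{M}}$ is a Whitney stratification of $\mathcal{M}$ such that: (i) $F$ is a weakly stratified map with respect to $\mathcal{S}_{\mathcal{M}}$ and $\Omega(\mathbb{R}^K)$; (ii) the restriction of $F$ to each stratum of $\mathcal{S}_{\mathcal{M}}$ is $C^r$; (iii) for every $\theta\in\mathcal{M}$ and every stratum $\mathcal{M}'\in\mathcal{S}_{\mathcal{M}}$ incident to $\theta$, there is an open neighborhood $U$ of $\theta$ in $\mathcal{M}$ such that $F_{|\mathcal{M}'\cap U}$ extends to a $C^r$ map $U\to\mathbb{R}^K$. Then, at every $\theta\in\mathcal{M}$, the map $B_p$ is $r$-differentiable along each stratum incident to $\theta$. In particular, $B_p$ is $r$-differentiable at every point of each top-dimensional stratum.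
   Context: Barcodes: a barcode is a multiset $D=D'\cup\Delta^\infty$, where $D'$ is a finite multiset of elements of $\mathbb{R}\times(\mathbb{R}\cup\{+\infty\})$ and $\Delta^\infty$ consists of the diagonal $\Delta=\{(b,b)\mid b\in\mathbb{R}\}$ with countably infinite multiplicity. $Bar$ is the set of barcodes. For $m,n\in\mathbb{N}$, $Q_{m,n}:\mathbb{R}^{2m}\times\mathbb{R}^n\to Bar$ is $Q_{m,n}(b_1,d_1,\dots,b_m,d_m,v_1,\dots,v_n)=\{(b_i,d_i)\}_{i=1}^m\cup\{(v_j,+\infty)\}_{j=1}^n\cup\Delta^\infty$. A map $B:\mathcal{M}\to Bar$ is $r$-differentiable at $x$ if there are an open neighborhood $U$ of $x$, integers $m,n\in\mathbb{N}$ and a $C^r$ map $\tilde B:U\to\mathbb{R}^{2m}\times\mathbb{R}^n$ with $B=Q_{m,n}\circ\tilde B$ on $U$. Filter functions: $f:K\to\mathbb{R}$ is a filter function if $f(\sigma)\le f(\sigma')$ whenever $\sigma\subseteq\sigma'$ are simplices of $K$. $\mathrm{Dgm}_p(f)\in Bar$ denotes the degree-$p$ barcode of $f$: with $K^t=\{\sigma\in K\mid f(\sigma)\le t\}$ and homology over a fixed field, the persistence module $(H_p(K^t))_{t\in\mathbb{R}}$ with maps induced by inclusions is isomorphic to a finite direct sum of interval modules $\bigoplus_{J\in\mathcal{J}}\mathbb{I}_J$, and $\mathrm{Dgm}_p(f)=\{(\inf J,\sup J)\}_{J\in\mathcal{J}}\cup\Delta^\infty$. Stratifications: a Whitney stratification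 of a smooth manifold $\mathcal{M}$ is a locally finite partition of $\mathcal{M}$ into connected smooth submanifolds (strata, not necessarily closed) such that for each stratum $\mathcal{M}'$ the set $\overline{\mathcal{M}'}\setminus\mathcal{M}'$ is a union of strata, and such that Whitney's condition (b) holds for every pair of strata. $\Omega(\mathbb{R}^K)$ is the Whitney stratification of $\mathbb{R}^K$ whose strata are the ordering equivalence classes, where $f,g\in\mathbb{R}^K$ are ordering equivalent if for all $\sigma,\sigma'\in K$, $f(\sigma)\le f(\sigma')\iff g(\sigma)\le g(\sigma')$ (i.e. the stratification obtained by cutting $\mathbb{R}^K$ with the hyperplanes $\{f(\sigma)=f(\sigma')\}$, $\sigma\ne\sigma'$). A map between stratified manifolds is weakly stratified if the pre-image of every stratum of the target is a union of strata of the source. A stratum $\mathcal{M}'$ is incident to $\theta\in\mathcal{M}$ if $\theta\in\overline{\mathcal{M}'}$ (closure in $\mathcal{M}$). Differentiability along a stratum: for a stratum $\mathcal{M}'$ incident to $\theta$, a map $B:\mathcal{M}\to Bar$ is $r$-differentiable at $\theta$ along $\mathcal{M}'$ if there are an open neighborhood $U$ of $\theta$ in $\mathcal{M}$, integers $m,n$, and a $C^r$ map $\tilde B:U\to\mathbb{R}^{2m}\times\mathbb{R}^n$ such that $B=Q_{m,n}\circ\tilde B$ on $U\cap\mathcal{M}'$. *)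

theory Defs
  imports "HOL-Analysis.Analysis" "HOL-Library.Multiset" "HOL-Library.Extended_Nat"
begin

section \<open>Smooth manifolds\<close>

text \<open>
  The model space \<open>\<real>\<^sup>n\<close> is the library's \<^const>\<open>Euclidean_space\<close> \<open>n\<close>, i.e. sequences supported on
  \<open>{..<n}\<close>, so that the dimension is a natural number (possibly 0) and \<open>\<real>\<^sup>k\<close> is literally
  contained in \<open>\<real>\<^sup>n\<close> for \<open>k \<le> n\<close>.
  \<open>Cr n r W g\<close>, for \<open>W\<close> open in \<open>\<real>\<^sup>n\<close>: all iterated partial derivatives of \<open>g\<close> of order at most \<open>r\<close>
  exist and are continuous on \<open>W\<close>.
\<close>

primrec Cr :: "nat \<Rightarrow> nat \<Rightarrow> (nat \<Rightarrow> real) set \<Rightarrow> ((nat \<Rightarrow> real) \<Rightarrow> real) \<Rightarrow> bool" where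
  "Cr n 0 W g \<longleftrightarrow> continuous_map (subtopology (Euclidean_space n) W) euclideanreal g"
| "Cr n (Suc r) W g \<longleftrightarrow>
     continuous_map (subtopology (Euclidean_space n) W) euclideanreal g \<and>
     (\<forall>i<n. \<exists>g'. (\<forall>x\<in>W. ((\<lambda>t. g (x(i := t))) has_real_derivative g' x) (at (x i))) \<and> Cr n r W g')"

type_synonym 'a chart = "'a set \<times> ('a \<Rightarrow> nat \<Rightarrow> real)"

record 'a manifold =
  mtop :: "'a topology"
  mdim :: nat
  atlas :: "'a chart set"

definition is_chart :: "'a topology \<Rightarrow> nat \<Rightarrow> 'a chart \<Rightarrow> bool" where
  "is_chart X d c \<longleftrightarrow> (case c of (U, \<phi>) \<Rightarrow>
     openin X U \<and> openin (Euclidean_space d) (\<phi> ` U) \<and>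
     homeomorphic_map (subtopology X U) (subtopology (Euclidean_space d) (\<phi> ` U)) \<phi>)"

definition smoothly_compatible :: "nat \<Rightarrow> 'a chart \<Rightarrow> 'a chart \<Rightarrow> bool" where
  "smoothly_compatible d c c' \<longleftrightarrow> (case c of (U, \<phi>) \<Rightarrow> case c' of (V, \<psi>) \<Rightarrow>
     \<forall>r. \<forall>j<d. Cr d r (\<phi> ` (U \<inter> V)) (\<lambda>x. \<psi> (inv_into U \<phi> x) j) \<and>
               Cr d r (\<psi> ` (U \<inter> V)) (\<lambda>x. \<phi> (inv_into V \<psi> x) j))"

definition smooth_manifold :: "'a manifold \<Rightarrow> bool" where
  "smooth_manifold M \<longleftrightarrow>
     Hausdorff_space (mtop M) \<and> second_countable (mtop M) \<and>
     (\<Union>c\<in>atlas M. fst c) = topspace (mtop M) \<and>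
     (\<forall>c\<in>atlas M. is_chart (mtop M) (mdim M) c) \<and>
     (\<forall>c\<in>atlas M. \<forall>c'\<in>atlas M. smoothly_compatible (mdim M) c c')"

text \<open>The charts of the maximal smooth atlas.\<close>

definition smooth_charts :: "'a manifold \<Rightarrow> 'a chart set" where
  "smooth_charts M =
     {c. is_chart (mtop M) (mdim M) c \<and> (\<forall>c'\<in>atlas M. smoothly_compatible (mdim M) c c')}"

text \<open>
  \<open>C\<^sup>r\<close> maps from an open set \<open>U\<close> of \<open>M\<close> into \<open>\<real>\<^sup>I\<close> (\<open>I\<close> a finite index set), which amounts to
  every coordinate function being \<open>C\<^sup>r\<close>.
\<close>

definition Cr_map :: "'a manifold \<Rightarrow> nat \<Rightarrow> 'a set \<Rightarrow> 'i set \<Rightarrow> ('a \<Rightarrow> 'i \<Rightarrow> real) \<Rightarrow> bool" where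
  "Cr_map M r U I G \<longleftrightarrow> (\<forall>i\<in>I. \<forall>(V, \<phi>)\<in>smooth_charts M.
     Cr (mdim M) r (\<phi> ` (U \<inter> V)) (\<lambda>x. G (inv_into V \<phi> x) i))"

section \<open>Embedded submanifolds\<close>

definition slice_charts :: "'a manifold \<Rightarrow> nat \<Rightarrow> 'a set \<Rightarrow> 'a chart set" where
  "slice_charts M k N =
     {(U, \<phi>) \<in> smooth_charts M. \<phi> ` (U \<inter> N) = \<phi> ` U \<inter> topspace (Euclidean_space k)}"

definition submanifold :: "'a manifold \<Rightarrow> nat \<Rightarrow> 'a set \<Rightarrow> bool" where
  "submanifold M k N \<longleftrightarrow>
     k \<le> mdim M \<and> N \<subseteq> topspace (mtop M) \<and> (\<forall>x\<in>N. \<exists>(U, \<phi>)\<in>slice_charts M k N. x \<in> U)"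

text \<open>
  A \<open>k\<close>-dimensional submanifold \<open>N\<close> is itself a smooth manifold, with charts the restrictions to
  \<open>N\<close> of its slice charts; the following is \<open>C\<^sup>r\<close> differentiability on \<open>N\<close> for that structure.
\<close>

definition Cr_map_on_submanifold ::
    "'a manifold \<Rightarrow> nat \<Rightarrow> nat \<Rightarrow> 'a set \<Rightarrow> 'i set \<Rightarrow> ('a \<Rightarrow> 'i \<Rightarrow> real) \<Rightarrow> bool" where
  "Cr_map_on_submanifold M k r N I G \<longleftrightarrow> (\<forall>i\<in>I. \<forall>(V, \<phi>)\<in>slice_charts M k N.
     Cr k r (\<phi> ` (V \<inter> N)) (\<lambda>x. G (inv_into V \<phi> x) i))"

text \<open>
  The tangent space of \<open>N\<close> at \<open>y\<close> read in the chart \<open>(U, \<phi>)\<close>: the velocities at time 0 of curves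
  in \<open>\<phi> ` (U \<inter> N)\<close> through \<open>\<phi> y\<close>.  For an embedded submanifold differentiability of the curve at 0
  is enough to get exactly the image of the tangent space under the differential of \<open>\<phi>\<close>.
\<close>

definition tangent_space :: "'a chart \<Rightarrow> 'a set \<Rightarrow> 'a \<Rightarrow> (nat \<Rightarrow> real) set" where
  "tangent_space c N y = (case c of (U, \<phi>) \<Rightarrow>
     {v. \<exists>\<gamma>. \<gamma> 0 = \<phi> y \<and> (\<forall>\<^sub>F t in at 0. \<gamma> t \<in> \<phi> ` (U \<inter> N)) \<and>
             (\<forall>j. ((\<lambda>t::real. \<gamma> t j) has_real_derivative v j) (at 0))})"

section \<open>Whitney stratifications\<close>

definition lin_comb :: "nat \<Rightarrow> (nat \<Rightarrow> real) \<Rightarrow> (nat \<Rightarrow> nat \<Rightarrow> real) \<Rightarrow> nat \<Rightarrow> real" where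
  "lin_comb k a v = (\<lambda>j. \<Sum>i<k. a i * v i j)"

definition lin_span :: "nat \<Rightarrow> (nat \<Rightarrow> nat \<Rightarrow> real) \<Rightarrow> (nat \<Rightarrow> real) set" where
  "lin_span k v = range (\<lambda>a. lin_comb k a v)"

definition frame :: "nat \<Rightarrow> nat \<Rightarrow> (nat \<Rightarrow> nat \<Rightarrow> real) \<Rightarrow> bool" where
  "frame d k v \<longleftrightarrow> (\<forall>i<k. v i \<in> topspace (Euclidean_space d)) \<and>
     (\<forall>a. lin_comb k a v = (\<lambda>_. 0) \<longrightarrow> (\<forall>i<k. a i = 0))"

text \<open>
  Convergence of a sequence of linear subspaces in the Grassmannian \<open>Gr(k, \<real>\<^sup>d)\<close>.  The Grassmannian
  carries the quotient topology from the space of \<open>k\<close>-frames, and this quotient map has local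
  sections, so convergence means that there are bases converging to a basis of the limit.
\<close>

definition Gr_tendsto ::
    "nat \<Rightarrow> nat \<Rightarrow> (nat \<Rightarrow> (nat \<Rightarrow> real) set) \<Rightarrow> (nat \<Rightarrow> real) set \<Rightarrow> bool" where
  "Gr_tendsto d k T \<tau> \<longleftrightarrow>
     (\<exists>v w. (\<forall>n. frame d k (v n) \<and> T n = lin_span k (v n)) \<and> frame d k w \<and> \<tau> = lin_span k w \<and>
            (\<forall>i<k. \<forall>j<d. (\<lambda>n. v n i j) \<longlonglongrightarrow> w i j))"

text \<open>
  Whitney's condition (b) for the pair \<open>(N', N)\<close>: if sequences \<open>x\<close> in \<open>N'\<close> and \<open>y\<close> in \<open>N\<close> converge to
  a point \<open>z\<close> of \<open>N'\<close>, and in a chart around \<open>z\<close> the secant lines converge to a line \<open>L\<close> and the tangent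
  spaces of \<open>N\<close> at \<open>y\<close> to \<open>\<tau>\<close>, then \<open>L \<subseteq> \<tau>\<close>.
\<close>

definition whitney_b :: "'a manifold \<Rightarrow> 'a set \<Rightarrow> 'a set \<Rightarrow> bool" where
  "whitney_b M N' N \<longleftrightarrow>
     (\<forall>z\<in>N'. \<forall>(U, \<phi>)\<in>smooth_charts M. \<forall>x y L \<tau> k.
        z \<in> U \<and> (\<forall>n. x n \<in> U \<inter> N' \<and> y n \<in> U \<inter> N \<and> x n \<noteq> y n) \<and>
        limitin (mtop M) x z sequentially \<and> limitin (mtop M) y z sequentially \<and>
        Gr_tendsto (mdim M) 1 (\<lambda>n. lin_span 1 (\<lambda>_ j. \<phi> (y n) j - \<phi> (x n) j)) L \<and>
        Gr_tendsto (mdim M) k (\<lambda>n. tangent_space (U, \<phi>) N (y n)) \<tau>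
        \<longrightarrow> L \<subseteq> \<tau>)"

definition whitney_stratification :: "'a manifold \<Rightarrow> 'a set set \<Rightarrow> bool" where
  "whitney_stratification M \<S> \<longleftrightarrow>
     partition_on (topspace (mtop M)) \<S> \<and>
     (\<forall>z\<in>topspace (mtop M). \<exists>U. openin (mtop M) U \<and> z \<in> U \<and> finite {N\<in>\<S>. N \<inter> U \<noteq> {}}) \<and>
     (\<forall>N\<in>\<S>. connectedin (mtop M) N \<and> (\<exists>k. submanifold M k N)) \<and>
     (\<forall>N\<in>\<S>. \<exists>\<T>\<subseteq>\<S>. (mtop M) closure_of N - N = \<Union>\<T>) \<and>
     (\<forall>N'\<in>\<S>. \<forall>N\<in>\<S>. whitney_b M N' N)"

definition incident :: "'a manifold \<Rightarrow> 'a set \<Rightarrow> 'a \<Rightarrow> bool" where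
  "incident M N \<theta> \<longleftrightarrow> \<theta> \<in> (mtop M) closure_of N"

definition weakly_stratified :: "'a set \<Rightarrow> 'a set set \<Rightarrow> 'b set set \<Rightarrow> ('a \<Rightarrow> 'b) \<Rightarrow> bool" where
  "weakly_stratified A \<S> \<T> F \<longleftrightarrow> (\<forall>T\<in>\<T>. \<exists>\<C>\<subseteq>\<S>. {x\<in>A. F x \<in> T} = \<Union>\<C>)"

section \<open>Filter functions on simplicial complexes\<close>

definition abstract_simplicial_complex :: "'v set set \<Rightarrow> bool" where
  "abstract_simplicial_complex K \<longleftrightarrow>
     (\<forall>\<sigma>\<in>K. finite \<sigma> \<and> \<sigma> \<noteq> {}) \<and> (\<forall>\<sigma>\<in>K. \<forall>\<tau>. \<tau> \<subseteq> \<sigma> \<and> \<tau> \<noteq> {} \<longrightarrow> \<tau> \<in> K)"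

definition filter_function :: "'v set set \<Rightarrow> ('v set \<Rightarrow> real) \<Rightarrow> bool" where
  "filter_function K f \<longleftrightarrow> (\<forall>\<sigma>\<in>K. \<forall>\<sigma>'\<in>K. \<sigma> \<subseteq> \<sigma>' \<longrightarrow> f \<sigma> \<le> f \<sigma>')"

definition sublevel :: "'v set set \<Rightarrow> ('v set \<Rightarrow> real) \<Rightarrow> real \<Rightarrow> 'v set set" where
  "sublevel K f t = {\<sigma>\<in>K. f \<sigma> \<le> t}"

definition real_functions :: "'s set \<Rightarrow> ('s \<Rightarrow> real) set" where
  "real_functions K = (\<Pi>\<^sub>E \<sigma>\<in>K. UNIV)"

definition ordering_equiv :: "'s set \<Rightarrow> (('s \<Rightarrow> real) \<times> ('s \<Rightarrow> real)) set" where
  "ordering_equiv K = {(f, g). f \<in> real_functions K \<and> g \<in> real_functions K \<and>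
     (\<forall>\<sigma>\<in>K. \<forall>\<sigma>'\<in>K. f \<sigma> \<le> f \<sigma>' \<longleftrightarrow> g \<sigma> \<le> g \<sigma>')}"

definition ordering_strata :: "'s set \<Rightarrow> ('s \<Rightarrow> real) set set" where
  "ordering_strata K = real_functions K // ordering_equiv K"

section \<open>Simplicial homology with field coefficients\<close>

text \<open>
  Oriented simplicial chains.  A list \<open>[v\<^sub>0, \<dots>, v\<^sub>p]\<close> of distinct vertices stands for the
  correspondingly oriented simplex; a \<open>p\<close>-chain gives each oriented \<open>p\<close>-simplex its coefficient, and
  changes sign under a transposition of the vertices.
\<close>

definition chains :: "'v set set \<Rightarrow> nat \<Rightarrow> ('v list \<Rightarrow> 'k::field) set" where
  "chains K p = {c.
     (\<forall>xs. c xs \<noteq> 0 \<longrightarrow> length xs = Suc p \<and> distinct xs \<and> set xs \<in> K) \<and>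
     (\<forall>xs i j. i < length xs \<and> j < length xs \<and> i \<noteq> j \<longrightarrow> c (xs[i := xs ! j, j := xs ! i]) = - c xs)}"

text \<open>
  The face of \<open>[v\<^sub>0, \<dots>, v\<^sub>p]\<close> omitting \<open>v\<^sub>i\<close> occurs in the usual boundary with sign \<open>(-1)\<^sup>i\<close>, which is
  the sign of moving \<open>v\<^sub>i\<close> to the front.  Hence the coefficient of the boundary of \<open>c\<close> at \<open>ys\<close> is the
  sum of the coefficients of \<open>c\<close> at all \<open>v # ys\<close>.  The empty list is excluded: 0-chains have boundary 0
  (no augmentation).
\<close>

definition boundary :: "'v set set \<Rightarrow> ('v list \<Rightarrow> 'k::field) \<Rightarrow> 'v list \<Rightarrow> 'k" where
  "boundary K c ys = (if ys = [] then 0 else \<Sum>v\<in>\<Union>K. c (v # ys))"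

definition cycles :: "'v set set \<Rightarrow> nat \<Rightarrow> ('v list \<Rightarrow> 'k::field) set" where
  "cycles K p = {c \<in> chains K p. boundary K c = (\<lambda>_. 0)}"

definition boundaries :: "'v set set \<Rightarrow> nat \<Rightarrow> ('v list \<Rightarrow> 'k::field) set" where
  "boundaries K p = boundary K ` chains K (Suc p)"

definition homology_class :: "'v set set \<Rightarrow> nat \<Rightarrow> ('v list \<Rightarrow> 'k::field) \<Rightarrow> ('v list \<Rightarrow> 'k) set" where
  "homology_class K p z = {\<lambda>xs. z xs + b xs |b. b \<in> boundaries K p}"

section \<open>Persistence modules\<close>

text \<open>
  A family of vector spaces over the field \<open>'k\<close> indexed by \<open>\<real>\<close>, with structure maps
  \<open>pmap V s t\<close> from the space at \<open>s\<close> to the space at \<open>t\<close> for \<open>s \<le> t\<close>.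
\<close>

record ('k, 'x) persistence =
  pspace :: "real \<Rightarrow> 'x set"
  padd :: "real \<Rightarrow> 'x \<Rightarrow> 'x \<Rightarrow> 'x"
  pscale :: "real \<Rightarrow> 'k \<Rightarrow> 'x \<Rightarrow> 'x"
  pmap :: "real \<Rightarrow> real \<Rightarrow> 'x \<Rightarrow> 'x"

definition persistence_iso :: "('k, 'x) persistence \<Rightarrow> ('k, 'y) persistence \<Rightarrow> bool" where
  "persistence_iso V W \<longleftrightarrow> (\<exists>\<Phi>.
     (\<forall>t. bij_betw (\<Phi> t) (pspace V t) (pspace W t) \<and>
          (\<forall>x\<in>pspace V t. \<forall>y\<in>pspace V t. \<Phi> t (padd V t x y) = padd W t (\<Phi> t x) (\<Phi> t y)) \<and>
          (\<forall>a. \<forall>x\<in>pspace V t. \<Phi> t (pscale V t a x) = pscale W t a (\<Phi> t x))) \<and>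
     (\<forall>s t. s \<le> t \<longrightarrow> (\<forall>x\<in>pspace V s. \<Phi> t (pmap V s t x) = pmap W s t (\<Phi> s x))))"

definition interval_module :: "real set \<Rightarrow> ('k::field, 'k) persistence" where
  "interval_module J =
     \<lparr> pspace = (\<lambda>t. if t \<in> J then UNIV else {0}),
       padd = (\<lambda>_ x y. x + y),
       pscale = (\<lambda>_ a x. a * x),
       pmap = (\<lambda>s t x. if s \<in> J \<and> t \<in> J then x else 0) \<rparr>"

definition direct_sum :: "('k, 'x) persistence list \<Rightarrow> ('k, nat \<Rightarrow> 'x) persistence" where
  "direct_sum Vs =
     \<lparr> pspace = (\<lambda>t. \<Pi>\<^sub>E i\<in>{..<length Vs}. pspace (Vs ! i) t),
       padd = (\<lambda>t x y. \<lambda>i\<in>{..<length Vs}. padd (Vs ! i) t (x i) (y i)),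
       pscale = (\<lambda>t a x. \<lambda>i\<in>{..<length Vs}. pscale (Vs ! i) t a (x i)),
       pmap = (\<lambda>s t x. \<lambda>i\<in>{..<length Vs}. pmap (Vs ! i) s t (x i)) \<rparr>"

text \<open>
  \<open>t \<mapsto> H\<^sub>p(K\<^sup>t)\<close>, homology classes being cosets of boundaries; the structure maps are induced by
  inclusion, i.e. they send the class of a cycle in \<open>K\<^sup>s\<close> to its class in \<open>K\<^sup>t\<close>.
\<close>

definition persistent_homology ::
    "nat \<Rightarrow> 'v set set \<Rightarrow> ('v set \<Rightarrow> real) \<Rightarrow> ('k::field, ('v list \<Rightarrow> 'k) set) persistence" where
  "persistent_homology p K f =
     \<lparr> pspace = (\<lambda>t. homology_class (sublevel K f t) p ` cycles (sublevel K f t) p),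
       padd = (\<lambda>t X Y. {\<lambda>xs. x xs + y xs |x y. x \<in> X \<and> y \<in> Y}),
       pscale = (\<lambda>t a X. \<Union>x\<in>X. homology_class (sublevel K f t) p (\<lambda>xs. a * x xs)),
       pmap = (\<lambda>s t X. \<Union>x\<in>X. homology_class (sublevel K f t) p x) \<rparr>"

section \<open>Barcodes\<close>

text \<open>
  A barcode is given by its multiplicity function; the points \<open>(b, b)\<close> of the diagonal have
  multiplicity \<open>\<infinity>\<close>, and \<open>with_diagonal D'\<close> is \<open>D' \<union> \<Delta>\<^sup>\<infinity>\<close>.
\<close>

type_synonym barcode = "real \<times> ereal \<Rightarrow> enat"

definition with_diagonal :: "(real \<times> ereal) multiset \<Rightarrow> barcode" where
  "with_diagonal D' = (\<lambda>(b, d). enat (count D' (b, d)) + (if d = ereal b then \<infinity> else 0))"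

definition Bar :: "barcode set" where
  "Bar = {with_diagonal D' |D'. \<forall>(b, d)\<in>#D'. d \<noteq> -\<infinity>}"

text \<open>The coordinates \<open>b\<^sub>1, d\<^sub>1, \<dots>, b\<^sub>m, d\<^sub>m\<close> and \<open>v\<^sub>1, \<dots>, v\<^sub>n\<close> are numbered from 0.\<close>

definition Q :: "nat \<Rightarrow> nat \<Rightarrow> (nat \<Rightarrow> real) \<times> (nat \<Rightarrow> real) \<Rightarrow> barcode" where
  "Q m n = (\<lambda>(u, v). with_diagonal
     (image_mset (\<lambda>i. (u (2 * i), ereal (u (2 * i + 1)))) (mset_set {..<m}) +
      image_mset (\<lambda>j. (v j, \<infinity>)) (mset_set {..<n})))"

definition interval_decomposition :: "('k::field, 'x) persistence \<Rightarrow> real set list \<Rightarrow> bool" where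
  "interval_decomposition V Js \<longleftrightarrow>
     (\<forall>J\<in>set Js. is_interval J \<and> J \<noteq> {}) \<and>
     persistence_iso V (direct_sum (map interval_module Js))"

text \<open>
  The degree-\<open>p\<close> barcode of \<open>f\<close>, with homology over the field \<open>'k\<close>; it does not depend on the chosen
  decomposition.
\<close>

definition Dgm :: "'k::field itself \<Rightarrow> nat \<Rightarrow> 'v set set \<Rightarrow> ('v set \<Rightarrow> real) \<Rightarrow> barcode" where
  "Dgm _ p K f = (THE D. \<exists>Js.
     interval_decomposition
       (persistent_homology p K f :: ('k, ('v list \<Rightarrow> 'k) set) persistence) Js \<and>
     D = with_diagonal (image_mset (\<lambda>J. (Inf J, SUP t\<in>J. ereal t)) (mset Js)))"

section \<open>Differentiability of barcode-valued maps\<close>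

definition Cr_lift ::
    "'a manifold \<Rightarrow> nat \<Rightarrow> 'a set \<Rightarrow> nat \<Rightarrow> nat \<Rightarrow> ('a \<Rightarrow> (nat \<Rightarrow> real) \<times> (nat \<Rightarrow> real)) \<Rightarrow> bool" where
  "Cr_lift M r U m n B' \<longleftrightarrow>
     Cr_map M r U {..<2 * m} (\<lambda>x. fst (B' x)) \<and> Cr_map M r U {..<n} (\<lambda>x. snd (B' x))"

definition r_differentiable_at :: "'a manifold \<Rightarrow> nat \<Rightarrow> ('a \<Rightarrow> barcode) \<Rightarrow> 'a \<Rightarrow> bool" where
  "r_differentiable_at M r B \<theta> \<longleftrightarrow>
     B \<in> topspace (mtop M) \<rightarrow> Bar \<and>
     (\<exists>U m n B'. openin (mtop M) U \<and> \<theta> \<in> U \<and> Cr_lift M r U m n B' \<and>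
        (\<forall>x\<in>U. B x = Q m n (B' x)))"

definition r_differentiable_along ::
    "'a manifold \<Rightarrow> nat \<Rightarrow> ('a \<Rightarrow> barcode) \<Rightarrow> 'a \<Rightarrow> 'a set \<Rightarrow> bool" where
  "r_differentiable_along M r B \<theta> N \<longleftrightarrow>
     B \<in> topspace (mtop M) \<rightarrow> Bar \<and>
     (\<exists>U m n B'. openin (mtop M) U \<and> \<theta> \<in> U \<and> Cr_lift M r U m n B' \<and>
        (\<forall>x\<in>U \<inter> N. B x = Q m n (B' x)))"

end

theory Submission
  imports Defs "HOL-Library.Function_Algebras"
begin

text \<open>
  Fix a stratum \<open>N\<close>.  Since \<open>F\<close> is weakly stratified, all functions \<open>F x\<close> with \<open>x \<in> N\<close> order the simplices
  in the same way (\<open>stratum_ordering_equiv\<close>).  Their sublevel sets therefore form one and the same finite chain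
  of complexes; only the times at which the complexes are reached depend on \<open>x\<close>.

  The \<open>p\<close>-cycles and the \<open>p\<close>-boundaries of these complexes are two flags in the space of \<open>p\<close>-chains, and
  homology is their quotient.  Two flags have a common adapted basis (\<open>adapted_basis\<close>), and such a basis splits
  the persistence module into interval modules: a basis vector contributes the interval from the time it
  becomes a cycle to the time it becomes a boundary (\<open>adapted_basis_decomposition\<close>).  Either event takes place
  at the value of a simplex that depends on the chain of complexes alone (\<open>entry_time\<close>).  Consequently there are
  simplices, fixed for the whole stratum, such that the barcode of \<open>F x\<close> consists of points \<open>(F x \<sigma>, F x \<tau>)\<close>
  and \<open>(F x \<sigma>, \<infinity>)\<close> (\<open>persistence_pairing\<close>).  Near a point of the closure of \<open>N\<close>, replacing \<open>F\<close> by its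
  \<open>C\<^sup>r\<close> extension gives the required lift (\<open>Dgm_smooth_lift_on_stratum\<close>).  A top-dimensional stratum is open,
  so differentiability along it is differentiability.

  To speak of \<^emph>\<open>the\<close> barcode one needs that all interval decompositions of a module have the same endpoints
  (\<open>barcode_unique\<close>).  The number of intervals that contain both \<open>s\<close> and \<open>t\<close> is the rank of the structure map
  from \<open>s\<close> to \<open>t\<close>, an isomorphism invariant, and these ranks determine the endpoints off the diagonal.
\<close>

section \<open>Bases adapted to two flags\<close>

context vector_space
begin

text \<open>
  The induction runs up the flag \<open>B\<close>.  New basis vectors at step \<open>m\<close> are taken from \<open>Z \<inter> B m\<close>.  An
  element of \<open>Z \<inter> B m\<close> then splits as \<open>z + d\<close> with \<open>z \<in> span E\<close> and \<open>d\<close> in the span of new vectors, hence in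
  \<open>B m\<close>; so \<open>z\<close> lies in \<open>span E \<inter> B m\<close> and is already covered by \<open>E \<inter> B m\<close>.  That the new vectors lie
  in the flag is what makes this splitting work, and is carried along in the induction.
\<close>
lemma extend_adapted_within_flag:
  fixes B :: "'i::linorder \<Rightarrow> 'b set"
  assumes "finite J" and B: "\<And>j. j \<in> J \<Longrightarrow> subspace (B j)"
    and mono: "\<And>i j. i \<in> J \<Longrightarrow> j \<in> J \<Longrightarrow> i \<le> j \<Longrightarrow> B i \<subseteq> B j"
    and E: "independent E" "E \<subseteq> Z" and Z: "subspace Z"
    and adapted: "\<And>j. j \<in> J \<Longrightarrow> span E \<inter> B j \<subseteq> span (E \<inter> B j)"
  shows "\<exists>E'. E \<subseteq> E' \<and> E' \<subseteq> Z \<and> independent E' \<and> E' \<subseteq> E \<union> (\<Union>j\<in>J. B j) \<and>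
              (\<forall>j\<in>J. Z \<inter> B j \<subseteq> span (E' \<inter> B j))"
  using assms(1) B mono adapted
proof (induction J rule: finite_linorder_max_induct)
  case empty
  then show ?case using E by blast
next
  case (insert m J)
  have "\<exists>E'. E \<subseteq> E' \<and> E' \<subseteq> Z \<and> independent E' \<and> E' \<subseteq> E \<union> (\<Union>j\<in>J. B j) \<and>
      (\<forall>j\<in>J. Z \<inter> B j \<subseteq> span (E' \<inter> B j))"
    by (rule insert.IH) (use insert.prems in auto)
  then obtain E1 where E1: "E \<subseteq> E1" "E1 \<subseteq> Z" "independent E1" "E1 \<subseteq> E \<union> (\<Union>j\<in>J. B j)"
    "\<And>j. j \<in> J \<Longrightarrow> Z \<inter> B j \<subseteq> span (E1 \<inter> B j)"
    by blast
  obtain E2 where E2: "E1 \<subseteq> E2" "E2 \<subseteq> E1 \<union> (Z \<inter> B m)" "independent E2"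
    "E1 \<union> (Z \<inter> B m) \<subseteq> span E2"
    using maximal_independent_subset_extend[of E1 "E1 \<union> (Z \<inter> B m)"] E1(3) by blast
  have below: "B j \<subseteq> B m" if "j \<in> J" for j
    using insert.prems(2)[of j m] insert.hyps(2) that by force
  have Bm: "subspace (B m)"
    using insert.prems(1) by simp
  define D where "D = E2 - E"
  have D: "D \<subseteq> B m"
    using E1(4) E2(2) below unfolding D_def by blast
  have "E2 = E \<union> D"
    using E1(1) E2(1) unfolding D_def by blast
  have top: "Z \<inter> B m \<subseteq> span (E2 \<inter> B m)"
  proof
    fix v assume v: "v \<in> Z \<inter> B m"
    with E2(4) have "v \<in> span (E \<union> D)"
      using \<open>E2 = E \<union> D\<close> by auto
    then obtain z d where vzd: "v = z + d" "z \<in> span E" "d \<in> span D"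
      unfolding span_Un by blast
    have "d \<in> B m"
      using vzd(3) D span_minimal[OF _ Bm] by blast
    then have "z \<in> B m"
      using vzd(1) v subspace_diff[OF Bm, of v d] by simp
    then have "z \<in> span (E \<inter> B m)"
      using vzd(2) insert.prems(3)[of m] by auto
    moreover have "span (E \<inter> B m) \<subseteq> span (E2 \<inter> B m)" "span D \<subseteq> span (E2 \<inter> B m)"
      using \<open>E2 = E \<union> D\<close> D by (auto intro!: span_mono)
    ultimately show "v \<in> span (E2 \<inter> B m)"
      using vzd(1,3) by (auto intro: span_add)
  qed
  have "Z \<inter> B j \<subseteq> span (E2 \<inter> B j)" if "j \<in> J" for j
    using E1(5)[OF that] span_mono[of "E1 \<inter> B j" "E2 \<inter> B j"] E2(1) by blast
  moreover have "E2 \<subseteq> Z" "E2 \<subseteq> E \<union> (\<Union>j\<in>insert m J. B j)"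
    using E1(2,4) E2(2) by auto
  ultimately show ?case
    using top E1(1) E2(1,3) by (intro exI[of _ E2]) auto
qed

text \<open>
  Any two finite flags of subspaces have a common adapted basis.  No such statement holds for three flags; with
  two, the basis can be built up along \<open>Z\<close>, each step being refined along \<open>B\<close>.
\<close>
lemma adapted_basis:
  fixes Z B :: "'i::linorder \<Rightarrow> 'b set"
  assumes "finite I" "finite J"
    and Z: "\<And>i. i \<in> I \<Longrightarrow> subspace (Z i)" and B: "\<And>j. j \<in> J \<Longrightarrow> subspace (B j)"
    and monoZ: "\<And>i j. i \<in> I \<Longrightarrow> j \<in> I \<Longrightarrow> i \<le> j \<Longrightarrow> Z i \<subseteq> Z j"
    and monoB: "\<And>i j. i \<in> J \<Longrightarrow> j \<in> J \<Longrightarrow> i \<le> j \<Longrightarrow> B i \<subseteq> B j"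
  shows "\<exists>E. independent E \<and> E \<subseteq> (\<Union>i\<in>I. Z i) \<and> (\<forall>i\<in>I. Z i \<subseteq> span (E \<inter> Z i)) \<and>
             (\<forall>j\<in>J. span E \<inter> B j \<subseteq> span (E \<inter> B j))"
  using assms(1) Z monoZ
proof (induction I rule: finite_linorder_max_induct)
  case empty
  then show ?case
    using B subspace_0 by (intro exI[of _ "{}"]) (auto simp: independent_empty)
next
  case (insert m I)
  have "\<exists>E. independent E \<and> E \<subseteq> (\<Union>i\<in>I. Z i) \<and> (\<forall>i\<in>I. Z i \<subseteq> span (E \<inter> Z i)) \<and>
             (\<forall>j\<in>J. span E \<inter> B j \<subseteq> span (E \<inter> B j))"
    by (rule insert.IH) (use insert.prems in auto)
  then obtain E where E: "independent E" "E \<subseteq> (\<Union>i\<in>I. Z i)"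
    "\<And>i. i \<in> I \<Longrightarrow> Z i \<subseteq> span (E \<inter> Z i)"
    "\<And>j. j \<in> J \<Longrightarrow> span E \<inter> B j \<subseteq> span (E \<inter> B j)"
    by blast
  have below: "Z i \<subseteq> Z m" if "i \<in> I" for i
    using insert.prems(2)[of i m] insert.hyps(2) that by force
  then have EZ: "E \<subseteq> Z m"
    using E(2) by blast
  have Zm: "subspace (Z m)"
    using insert.prems(1) by simp
  have "\<exists>E'. E \<subseteq> E' \<and> E' \<subseteq> Z m \<and> independent E' \<and> E' \<subseteq> E \<union> (\<Union>j\<in>J. B j) \<and>
              (\<forall>j\<in>J. Z m \<inter> B j \<subseteq> span (E' \<inter> B j))"
    by (rule extend_adapted_within_flag[OF assms(2) _ _ E(1) EZ Zm]) (fact B monoB E(4))+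
  then obtain E1 where E1: "E \<subseteq> E1" "E1 \<subseteq> Z m" "independent E1"
    "\<And>j. j \<in> J \<Longrightarrow> Z m \<inter> B j \<subseteq> span (E1 \<inter> B j)"
    by (elim exE conjE) (rule that, assumption+, erule bspec)
  obtain E2 where E2: "E1 \<subseteq> E2" "E2 \<subseteq> Z m" "independent E2" "Z m \<subseteq> span E2"
    using maximal_independent_subset_extend[OF E1(2,3)] by blast
  have sp: "span E2 = Z m"
    using E2 Zm span_minimal by (intro equalityI) auto
  have "span E2 \<inter> B j \<subseteq> span (E2 \<inter> B j)" if "j \<in> J" for j
    using E1(4)[OF that] sp span_mono[of "E1 \<inter> B j" "E2 \<inter> B j"] E2(1) by blast
  moreover have "Z i \<subseteq> span (E2 \<inter> Z i)" if "i \<in> insert m I" for i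
  proof (cases "i = m")
    case True
    then show ?thesis
      using E2(2,4) by (simp add: Int_absorb2)
  next
    case False
    then show ?thesis
      using that E(3)[of i] span_mono[of "E \<inter> Z i" "E2 \<inter> Z i"] E1(1) E2(1) by blast
  qed
  ultimately show ?case
    using E2(2,3) by (intro exI[of _ E2]) auto
qed

end

section \<open>Sums of interval modules\<close>

lemma interval_sum_simps:
  "pspace (direct_sum (map interval_module Js)) t =
     (\<Pi>\<^sub>E i\<in>{..<length Js}. if t \<in> Js ! i then UNIV else {0 :: 'k::field})"
  "padd (direct_sum (map interval_module Js)) t x y = (\<lambda>i\<in>{..<length Js}. x i + y i :: 'k)"
  "pscale (direct_sum (map interval_module Js)) t a x = (\<lambda>i\<in>{..<length Js}. a * x i :: 'k)"
  "pmap (direct_sum (map interval_module Js)) s t x =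
     (\<lambda>i\<in>{..<length Js}. if s \<in> Js ! i \<and> t \<in> Js ! i then x i else (0 :: 'k))"
proof -
  show "pspace (direct_sum (map interval_module Js)) t =
     (\<Pi>\<^sub>E i\<in>{..<length Js}. if t \<in> Js ! i then UNIV else {0 :: 'k::field})"
    unfolding direct_sum_def by simp (intro PiE_cong, simp add: interval_module_def)
  show "padd (direct_sum (map interval_module Js)) t x y = (\<lambda>i\<in>{..<length Js}. x i + y i :: 'k)"
    unfolding direct_sum_def by simp (intro restrict_ext, simp add: interval_module_def)
  show "pscale (direct_sum (map interval_module Js)) t a x = (\<lambda>i\<in>{..<length Js}. a * x i :: 'k)"
    unfolding direct_sum_def by simp (intro restrict_ext, simp add: interval_module_def)
  show "pmap (direct_sum (map interval_module Js)) s t x =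
     (\<lambda>i\<in>{..<length Js}. if s \<in> Js ! i \<and> t \<in> Js ! i then x i else (0 :: 'k))"
    unfolding direct_sum_def by simp (intro restrict_ext, simp add: interval_module_def)
qed

section \<open>Subquotients of a vector space as persistence modules\<close>

definition coset :: "'b::ab_group_add set \<Rightarrow> 'b \<Rightarrow> 'b set" where
  "coset B z = {z + b |b. b \<in> B}"

text \<open>
  The family of quotients \<open>Z t / B t\<close>, realised by cosets in the ambient space in the same way as
  \<^const>\<open>persistent_homology\<close>.
\<close>
definition subquotient ::
    "('k \<Rightarrow> 'b \<Rightarrow> 'b) \<Rightarrow> (real \<Rightarrow> 'b::ab_group_add set) \<Rightarrow> (real \<Rightarrow> 'b set) \<Rightarrow> ('k, 'b set) persistence"
  where
  "subquotient sc Z B =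
     \<lparr> pspace = (\<lambda>t. coset (B t) ` Z t),
       padd = (\<lambda>t X Y. {x + y |x y. x \<in> X \<and> y \<in> Y}),
       pscale = (\<lambda>t a X. \<Union>x\<in>X. coset (B t) (sc a x)),
       pmap = (\<lambda>s t X. \<Union>x\<in>X. coset (B t) x) \<rparr>"

context vector_space
begin

lemma coset_eq_iff: "subspace B \<Longrightarrow> coset B x = coset B y \<longleftrightarrow> x - y \<in> B"
proof
  assume B: "subspace B" and eq: "coset B x = coset B y"
  have "x \<in> coset B x"
    using subspace_0[OF B] unfolding coset_def by force
  then show "x - y \<in> B"
    unfolding eq by (auto simp: coset_def)
next
  assume B: "subspace B" and d: "x - y \<in> B"
  have "z \<in> coset B x" if zy: "z \<in> coset B y" and d: "x - y \<in> B" for x y z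
  proof -
    obtain b where "z = y + b" "b \<in> B"
      using zy by (auto simp: coset_def)
    then have "z = x + (b - (x - y))" "b - (x - y) \<in> B"
      using subspace_diff[OF B _ d] by auto
    then show ?thesis
      unfolding coset_def by blast
  qed
  moreover have "y - x \<in> B"
    using subspace_neg[OF B d] by simp
  ultimately show "coset B x = coset B y"
    using d by blast
qed

lemma UN_coset:
  assumes "subspace B" "subspace B'" "B \<subseteq> B'" and f: "\<And>b. b \<in> B \<Longrightarrow> f (z + b) - f z \<in> B'"
  shows "(\<Union>x\<in>coset B z. coset B' (f x)) = coset B' (f z)"
proof -
  have "coset B' (f x) = coset B' (f z)" if "x \<in> coset B z" for x
    using that f coset_eq_iff[OF assms(2)] by (auto simp: coset_def)
  moreover have "z \<in> coset B z"
    using subspace_0[OF assms(1)] unfolding coset_def by force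
  ultimately show ?thesis by blast
qed

lemma coset_add:
  assumes B: "subspace B"
  shows "{x + y |x y. x \<in> coset B u \<and> y \<in> coset B v} = coset B (u + v)"
proof (intro equalityI subsetI)
  fix w assume "w \<in> {x + y |x y. x \<in> coset B u \<and> y \<in> coset B v}"
  then obtain b c where "w = (u + b) + (v + c)" "b \<in> B" "c \<in> B"
    by (auto simp: coset_def)
  then have "w = (u + v) + (b + c)" "b + c \<in> B"
    using subspace_add[OF B] by (auto simp: algebra_simps)
  then show "w \<in> coset B (u + v)"
    unfolding coset_def by blast
next
  fix w assume "w \<in> coset B (u + v)"
  then obtain b where b: "w = u + v + b" "b \<in> B"
    by (auto simp: coset_def)
  then have "w = u + (v + b)" "u \<in> coset B u" "v + b \<in> coset B v"
    using subspace_0[OF B] by (force simp: coset_def algebra_simps)+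
  then show "w \<in> {x + y |x y. x \<in> coset B u \<and> y \<in> coset B v}"
    by blast
qed

end

text \<open>
  A persistence module all of whose spaces are subquotients of one vector space, its structure maps being
  induced by inclusions.
\<close>
locale filtered_subquotient = vector_space scale
  for scale :: "'k::field \<Rightarrow> 'b::ab_group_add \<Rightarrow> 'b" (infixr \<open>*s\<close> 75) +
  fixes Z B :: "real \<Rightarrow> 'b set"
  assumes Z: "subspace (Z t)" and B: "subspace (B t)" and BZ: "B t \<subseteq> Z t"
    and monoZ: "s \<le> t \<Longrightarrow> Z s \<subseteq> Z t" and monoB: "s \<le> t \<Longrightarrow> B s \<subseteq> B t"
begin

abbreviation V where "V \<equiv> subquotient (*s) Z B"

lemma pspace_V: "pspace V t = coset (B t) ` Z t"
  by (simp add: subquotient_def)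

lemma padd_V: "padd V t (coset (B t) x) (coset (B t) y) = coset (B t) (x + y)"
  by (simp add: subquotient_def coset_add[OF B])

lemma pscale_V: "pscale V t a (coset (B t) x) = coset (B t) (a *s x)"
  unfolding subquotient_def
  by (simp, rule UN_coset[OF B B]) (auto simp: scale_right_distrib subspace_scale[OF B])

lemma pmap_V: "s \<le> t \<Longrightarrow> pmap V s t (coset (B s) x) = coset (B t) x"
  unfolding subquotient_def
  by (simp, rule UN_coset[OF B B monoB, where f = "\<lambda>x. x"]) (use monoB in auto)

text \<open>
  The times at which the coset of \<open>e\<close> is a nonzero element of \<open>Z t / B t\<close>.
\<close>
definition lifespan :: "'b \<Rightarrow> real set" where
  "lifespan e = {t. e \<in> Z t \<and> e \<notin> B t}"

lemma is_interval_lifespan: "is_interval (lifespan e)"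
  unfolding is_interval_1 lifespan_def using monoZ monoB by blast

text \<open>
  If \<open>E \<inter> Z t\<close> spans \<open>Z t\<close> and \<open>E \<inter> B t\<close> spans \<open>B t\<close>, the cosets of the vectors in \<open>Z t\<close> but not
  in \<open>B t\<close> form a basis of \<open>Z t / B t\<close>, and a structure map sends such a vector to itself or, once it has
  entered \<open>B\<close>, to 0.  Taking coordinates in \<open>E\<close> is therefore an isomorphism to the sum of the interval
  modules of the lifespans.
\<close>
theorem adapted_basis_decomposition:
  assumes E: "independent E"
    and adapted: "\<And>t. Z t \<subseteq> span (E \<inter> Z t)" "\<And>t. B t \<subseteq> span (E \<inter> B t)"
    and es: "distinct es" "set es = {e \<in> E. lifespan e \<noteq> {}}"
  shows "interval_decomposition V (map lifespan es)"
proof -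
  let ?n = "length es"
  let ?R = "representation E"
  let ?W = "direct_sum (map (interval_module \<circ> lifespan) es) :: ('k, nat \<Rightarrow> 'k) persistence"
  have supp: "e \<in> S" if "S \<subseteq> E" "z \<in> span S" "?R z e \<noteq> 0" for S z e
    using that representation_extend[OF E(1) that(2,1)] representation_ne_zero[of S z e] by simp
  have span_E: "z \<in> span E" if "z \<in> Z t" for z t
    using adapted(1)[of t] that span_mono[of "E \<inter> Z t" E] by blast
  have suppZ: "e \<in> E \<inter> Z t" if "z \<in> Z t" "?R z e \<noteq> 0" for z e t
    using supp[of "E \<inter> Z t" z e] adapted(1)[of t] that by blast
  have suppB: "e \<in> E \<inter> B t" if "z \<in> B t" "?R z e \<noteq> 0" for z e t
    using supp[of "E \<inter> B t" z e] adapted(2)[of t] that by blast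
  define \<Phi> where "\<Phi> t X = (\<lambda>i\<in>{..<?n}. if t \<in> lifespan (es ! i) then ?R (SOME x. x \<in> X) (es ! i) else 0)"
    for t X
  have \<Phi>: "\<Phi> t (coset (B t) z) = (\<lambda>i\<in>{..<?n}. if t \<in> lifespan (es ! i) then ?R z (es ! i) else 0)"
    if z: "z \<in> Z t" for t z
  proof -
    define x where "x = (SOME x. x \<in> coset (B t) z)"
    have "z \<in> coset (B t) z"
      using subspace_0[OF B[of t]] unfolding coset_def by force
    then have "x \<in> coset (B t) z"
      unfolding x_def by (rule someI)
    then obtain b where b: "x = z + b" "b \<in> B t"
      by (auto simp: coset_def)
    have "?R x e = ?R z e" if "t \<in> lifespan e" for e
    proof -
      have "?R b e = 0"
        using suppB[OF b(2), of e] that by (auto simp: lifespan_def)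
      moreover have "b \<in> Z t"
        using b(2) BZ by blast
      ultimately show ?thesis
        using b(1) representation_add[OF E(1) span_E[of b t] span_E[OF z]] by simp
    qed
    then show ?thesis
      unfolding \<Phi>_def x_def[symmetric] by (intro restrict_ext) simp
  qed
  have pspace_W: "pspace ?W t = (\<Pi>\<^sub>E i\<in>{..<?n}. if t \<in> lifespan (es ! i) then UNIV else {0})" for t
    unfolding map_map[symmetric] interval_sum_simps by (intro PiE_cong | simp)+
  have padd_W: "padd ?W t x y = (\<lambda>i\<in>{..<?n}. x i + y i)" for t x y
    using interval_sum_simps(2)[of "map lifespan es" t x y] by simp
  have pscale_W: "pscale ?W t a x = (\<lambda>i\<in>{..<?n}. a * x i)" for t a x
    using interval_sum_simps(3)[of "map lifespan es" t a x] by simp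
  have pmap_W: "pmap ?W s t x =
      (\<lambda>i\<in>{..<?n}. if s \<in> lifespan (es ! i) \<and> t \<in> lifespan (es ! i) then x i else 0)" for s t x
    using interval_sum_simps(4)[of "map lifespan es" s t x] by (simp cong: restrict_cong)
  have bij: "bij_betw (\<Phi> t) (pspace V t) (pspace ?W t)" for t
    unfolding bij_betw_def
  proof
    show "inj_on (\<Phi> t) (pspace V t)"
    proof (rule inj_onI)
      fix X Y assume "X \<in> pspace V t" "Y \<in> pspace V t" and eq: "\<Phi> t X = \<Phi> t Y"
      then obtain x y where x: "x \<in> Z t" "X = coset (B t) x" and y: "y \<in> Z t" "Y = coset (B t) y"
        by (auto simp: pspace_V)
      have d: "x - y \<in> Z t"
        using subspace_diff[OF Z x(1) y(1)] .
      have R: "?R (x - y) e = 0" if "e \<in> E" "t \<in> lifespan e" for e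
      proof -
        have "e \<in> set es"
          using es(2) that by auto
        then obtain i where i: "i < ?n" "e = es ! i"
          by (auto simp: in_set_conv_nth)
        then have "?R x e = ?R y e"
          using fun_cong[OF eq, of i] that(2) by (simp add: \<Phi> x y)
        then show ?thesis
          using representation_diff[OF E(1) span_E[OF y(1)] span_E[OF x(1)]] by simp
      qed
      \<comment> \<open>Every basis vector occurring in \<open>x - y\<close> lies in \<open>Z t\<close> without being alive at \<open>t\<close>, hence in \<open>B t\<close>.\<close>
      have "?R (x - y) e *s e \<in> B t" if "?R (x - y) e \<noteq> 0" for e
      proof -
        have "e \<in> B t"
          using suppZ[OF d that] R[of e] that by (auto simp: lifespan_def)
        then show ?thesis
          by (rule subspace_scale[OF B])
      qed
      then have "(\<Sum>e | ?R (x - y) e \<noteq> 0. ?R (x - y) e *s e) \<in> B t"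
        by (intro subspace_sum[OF B]) auto
      then have "x - y \<in> B t"
        using sum_nonzero_representation_eq[OF E(1) span_E[OF d]] by simp
      then show "X = Y"
        using x y coset_eq_iff[OF B] by simp
    qed
    show "\<Phi> t ` pspace V t = pspace ?W t"
    proof (intro equalityI subsetI)
      fix c assume "c \<in> \<Phi> t ` pspace V t"
      then obtain z where "z \<in> Z t" "c = \<Phi> t (coset (B t) z)"
        by (auto simp: pspace_V)
      then show "c \<in> pspace ?W t"
        by (simp add: pspace_W \<Phi> restrict_PiE_iff)
    next
      fix c assume c: "c \<in> pspace ?W t"
      define z where "z = (\<Sum>i<?n. c i *s es ! i)"
      have c0: "c i = 0" if "i < ?n" "t \<notin> lifespan (es ! i)" for i
        using PiE_mem[OF c[unfolded pspace_W], of i] that by simp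
      have "c i *s es ! i \<in> Z t" if "i < ?n" for i
      proof (cases "t \<in> lifespan (es ! i)")
        case True
        then show ?thesis
          by (intro subspace_scale[OF Z]) (simp add: lifespan_def)
      next
        case False
        then show ?thesis
          using c0[OF that] subspace_0[OF Z] by simp
      qed
      then have z: "z \<in> Z t"
        unfolding z_def by (intro subspace_sum[OF Z]) auto
      have inE: "es ! i \<in> E" if "i < ?n" for i
        using es(2) nth_mem[OF that] by blast
      have "?R z (es ! j) = c j" if j: "j < ?n" for j
      proof -
        have "?R z (es ! j) = (\<Sum>i<?n. ?R (c i *s es ! i) (es ! j))"
          using representation_sum[OF E(1), of "{..<?n}" "\<lambda>i. c i *s es ! i"]
            span_scale[OF span_base[OF inE]] by (simp add: z_def)
        also have "\<dots> = (\<Sum>i<?n. if i = j then c i else 0)"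
        proof (rule sum.cong)
          fix i assume i: "i \<in> {..<?n}"
          then have "?R (c i *s es ! i) (es ! j) = c i * ?R (es ! i) (es ! j)"
            using representation_scale[OF E(1) span_base[OF inE]] by simp
          also have "\<dots> = (if i = j then c i else 0)"
            using representation_basis[OF E(1) inE, of i] i j nth_eq_iff_index_eq[OF es(1), of j i]
            by auto
          finally show "?R (c i *s es ! i) (es ! j) = (if i = j then c i else 0)" .
        qed simp
        finally show ?thesis
          using j by simp
      qed
      then have "\<Phi> t (coset (B t) z) = (\<lambda>i\<in>{..<?n}. c i)"
        unfolding \<Phi>[OF z] by (intro restrict_ext) (simp add: c0)
      also have "\<dots> = c"
        using c by (simp add: pspace_W PiE_restrict)
      finally show "c \<in> \<Phi> t ` pspace V t"
        using z by (auto simp: pspace_V)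
    qed
  qed
  have add: "\<Phi> t (padd V t X Y) = padd ?W t (\<Phi> t X) (\<Phi> t Y)"
    if "X \<in> pspace V t" "Y \<in> pspace V t" for t X Y
  proof -
    obtain x y where x: "x \<in> Z t" "X = coset (B t) x" and y: "y \<in> Z t" "Y = coset (B t) y"
      using \<open>X \<in> pspace V t\<close> \<open>Y \<in> pspace V t\<close> by (auto simp: pspace_V)
    show ?thesis
      using representation_add[OF E(1) span_E[OF y(1)] span_E[OF x(1)]]
      unfolding x(2) y(2) padd_V padd_W \<Phi>[OF x(1)] \<Phi>[OF y(1)] \<Phi>[OF subspace_add[OF Z x(1) y(1)]]
      by (intro restrict_ext) simp
  qed
  have scale: "\<Phi> t (pscale V t a X) = pscale ?W t a (\<Phi> t X)" if "X \<in> pspace V t" for t a X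
  proof -
    obtain x where x: "x \<in> Z t" "X = coset (B t) x"
      using \<open>X \<in> pspace V t\<close> by (auto simp: pspace_V)
    show ?thesis
      using representation_scale[OF E(1) span_E[OF x(1)]]
      unfolding x(2) pscale_V pscale_W \<Phi>[OF x(1)] \<Phi>[OF subspace_scale[OF Z x(1)]]
      by (intro restrict_ext) simp
  qed
  have map: "\<Phi> t (pmap V s t X) = pmap ?W s t (\<Phi> s X)" if st: "s \<le> t" and "X \<in> pspace V s" for s t X
  proof -
    obtain x where x: "x \<in> Z s" "X = coset (B s) x"
      using \<open>X \<in> pspace V s\<close> by (auto simp: pspace_V)
    have xt: "x \<in> Z t"
      using x(1) monoZ[OF st] by blast
    have "?R x e = 0" if "t \<in> lifespan e" "s \<notin> lifespan e" for e
      using suppZ[OF x(1), of e] monoB[OF st] that by (auto simp: lifespan_def)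
    then show ?thesis
      unfolding x(2) pmap_V[OF st] pmap_W \<Phi>[OF xt] \<Phi>[OF x(1)] by (intro restrict_ext) auto
  qed
  have "persistence_iso V ?W"
    unfolding persistence_iso_def
    using bij add scale map by (intro exI[of _ \<Phi>]) blast
  moreover have "\<forall>J\<in>set (map lifespan es). is_interval J \<and> J \<noteq> {}"
    using es(2) is_interval_lifespan by auto
  ultimately show ?thesis
    unfolding interval_decomposition_def by simp
qed

end

text \<open>
  The record type does not force the operations to stay inside the spaces; transporting linear maps through
  an isomorphism needs that they do.
\<close>
definition persistence_closed :: "('k, 'x) persistence \<Rightarrow> bool" where
  "persistence_closed V \<longleftrightarrow>
     (\<forall>t. \<forall>x\<in>pspace V t. \<forall>y\<in>pspace V t. padd V t x y \<in> pspace V t) \<and>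
     (\<forall>t a. \<forall>x\<in>pspace V t. pscale V t a x \<in> pspace V t) \<and>
     (\<forall>s t. s \<le> t \<longrightarrow> (\<forall>x\<in>pspace V s. pmap V s t x \<in> pspace V t))"

lemma (in filtered_subquotient) persistence_closed_V: "persistence_closed V"
  unfolding persistence_closed_def
proof (intro conjI allI impI ballI)
  fix t X Y assume "X \<in> pspace V t" "Y \<in> pspace V t"
  then show "padd V t X Y \<in> pspace V t"
    using subspace_add[OF Z] by (auto simp: pspace_V padd_V)
next
  fix t a X assume "X \<in> pspace V t"
  then show "pscale V t a X \<in> pspace V t"
    using subspace_scale[OF Z] by (auto simp: pspace_V pscale_V)
next
  fix s t X assume "s \<le> t" "X \<in> pspace V s"
  then show "pmap V s t X \<in> pspace V t"
    using monoZ[OF \<open>s \<le> t\<close>] by (auto simp: pspace_V pmap_V)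
qed

section \<open>Spaces of functions\<close>

definition scale_fun :: "'k::field \<Rightarrow> ('x \<Rightarrow> 'k) \<Rightarrow> 'x \<Rightarrow> 'k" where
  "scale_fun a f = (\<lambda>x. a * f x)"

interpretation fun_space: vector_space scale_fun
  by unfold_locales (auto simp: scale_fun_def fun_eq_iff algebra_simps)

definition delta :: "'x \<Rightarrow> 'x \<Rightarrow> 'k::field" where
  "delta x = (\<lambda>y. if y = x then 1 else 0)"

lemma in_span_delta:
  fixes f :: "'x \<Rightarrow> 'k::field"
  assumes "finite X" "{x. f x \<noteq> 0} \<subseteq> X"
  shows "f \<in> fun_space.span (delta ` X)"
proof -
  have "f = (\<Sum>x\<in>X. scale_fun (f x) (delta x))"
  proof
    fix y
    have "(\<Sum>x\<in>X. scale_fun (f x) (delta x)) y = (\<Sum>x\<in>X. scale_fun (f x) (delta x) y)"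
      using assms(1) by (induction X rule: finite_induct) auto
    also have "\<dots> = (\<Sum>x\<in>X. if y = x then f x else 0)"
      by (intro sum.cong) (auto simp: delta_def scale_fun_def)
    also have "\<dots> = f y"
      using assms by auto
    finally show "f y = (\<Sum>x\<in>X. scale_fun (f x) (delta x)) y" ..
  qed
  also have "\<dots> \<in> fun_space.span (delta ` X)"
    by (intro fun_space.span_sum fun_space.span_scale fun_space.span_base) auto
  finally show ?thesis .
qed

text \<open>
  Invariance of dimension for the space of functions supported on a finite set, in a form that only asks
  \<open>T\<close> to be linear and injective on that space.
\<close>
lemma card_le_if_linear_inj:
  fixes T :: "('i \<Rightarrow> 'k::field) \<Rightarrow> 'j \<Rightarrow> 'k"
  assumes "finite I" "finite J"
    and maps: "\<And>x. {i. x i \<noteq> 0} \<subseteq> I \<Longrightarrow> {j. T x j \<noteq> 0} \<subseteq> J"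
    and inj: "inj_on T {x. {i. x i \<noteq> 0} \<subseteq> I}"
    and add: "\<And>x y. {i. x i \<noteq> 0} \<subseteq> I \<Longrightarrow> {i. y i \<noteq> 0} \<subseteq> I \<Longrightarrow>
        T (\<lambda>i. x i + y i) = (\<lambda>j. T x j + T y j)"
    and scale: "\<And>a x. {i. x i \<noteq> 0} \<subseteq> I \<Longrightarrow> T (\<lambda>i. a * x i) = (\<lambda>j. a * T x j)"
  shows "card I \<le> card J"
proof -
  define e :: "'i \<Rightarrow> 'i \<Rightarrow> 'k" where "e = delta"
  have e_supp: "{i'. e i i' \<noteq> 0} \<subseteq> I" if "i \<in> I" for i
    using that by (auto simp: e_def delta_def)
  have comb: "(\<Sum>i\<in>A. scale_fun (u i) (T (e i))) = T (\<lambda>i. if i \<in> A then u i else 0)"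
    if "finite A" "A \<subseteq> I" for A u
    using that
  proof (induction A rule: finite_induct)
    case empty
    have "T (\<lambda>i. 0) = (\<lambda>j. 0)"
      using scale[of "\<lambda>_. 0" 0] by simp
    then show ?case
      by (simp add: zero_fun_def)
  next
    case (insert a A)
    have "T (\<lambda>i. if i \<in> insert a A then u i else 0) =
        T (\<lambda>i. u a * e a i + (if i \<in> A then u i else 0))"
      using insert.hyps by (intro arg_cong[of _ _ T]) (auto simp: e_def delta_def)
    also have "\<dots> = (\<lambda>j. T (\<lambda>i. u a * e a i) j + T (\<lambda>i. if i \<in> A then u i else 0) j)"
      using insert.prems by (intro add) (auto simp: e_def delta_def split: if_splits)
    also have "T (\<lambda>i. u a * e a i) = (\<lambda>j. u a * T (e a) j)"
      using insert.prems by (intro scale) (auto simp: e_def delta_def)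
    finally show ?case
      using insert by (simp add: plus_fun_def scale_fun_def)
  qed
  have inj_e: "inj_on (\<lambda>i. T (e i)) I"
  proof (rule inj_onI)
    fix i k assume "i \<in> I" "k \<in> I" "T (e i) = T (e k)"
    then have "e i = e k"
      using inj_onD[OF inj] e_supp by blast
    then have "e i i = e k i"
      by simp
    then show "i = k"
      by (auto simp: e_def delta_def split: if_splits)
  qed
  have "fun_space.independent ((\<lambda>i. T (e i)) ` I)"
    unfolding fun_space.independent_explicit_finite_subsets
  proof (intro allI impI ballI)
    fix A u v
    assume A: "A \<subseteq> (\<lambda>i. T (e i)) ` I" "finite A" and s0: "(\<Sum>v\<in>A. scale_fun (u v) v) = 0" and v: "v \<in> A"
    obtain I' where I': "I' \<subseteq> I" "A = (\<lambda>i. T (e i)) ` I'"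
      using A(1) by (auto simp: subset_image_iff)
    then have "finite I'"
      using \<open>finite I\<close> finite_subset by blast
    have "0 = (\<Sum>i\<in>I'. scale_fun (u (T (e i))) (T (e i)))"
      using s0 inj_on_subset[OF inj_e I'(1)] by (simp add: I'(2) sum.reindex)
    also have "\<dots> = T (\<lambda>i. if i \<in> I' then u (T (e i)) else 0)"
      using comb[OF \<open>finite I'\<close> I'(1), of "\<lambda>i. u (T (e i))"] by simp
    finally have "T (\<lambda>i. if i \<in> I' then u (T (e i)) else 0) = T (\<lambda>i. 0)"
      using comb[of "{}" "\<lambda>_. 0"] by simp
    then have "(\<lambda>i. if i \<in> I' then u (T (e i)) else 0) = (\<lambda>i. 0)"
      using I'(1) by (intro inj_onD[OF inj]) auto
    moreover obtain i where "i \<in> I'" "v = T (e i)"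
      using v I'(2) by blast
    ultimately show "u v = 0"
      by (auto dest: fun_cong[of _ _ i])
  qed
  moreover have "(\<lambda>i. T (e i)) ` I \<subseteq> fun_space.span (delta ` J)"
  proof
    fix y assume "y \<in> (\<lambda>i. T (e i)) ` I"
    then have y: "{j. y j \<noteq> 0} \<subseteq> J"
      using maps e_supp by blast
    with \<open>finite J\<close> show "y \<in> fun_space.span (delta ` J)"
      by (rule in_span_delta)
  qed
  ultimately have "card ((\<lambda>i. T (e i)) ` I) \<le> card (delta ` J :: ('j \<Rightarrow> 'k) set)"
    using fun_space.independent_span_bound[of "delta ` J :: ('j \<Rightarrow> 'k) set"] \<open>finite J\<close> by simp
  also have "\<dots> \<le> card J"
    using \<open>finite J\<close> by (rule card_image_le)
  finally show ?thesis
    by (simp add: card_image[OF inj_e])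
qed

section \<open>Uniqueness of the barcode\<close>

text \<open>
  The number of these indices is the rank of the structure map from time \<open>s\<close> to time \<open>t\<close>.
\<close>
definition common_bars :: "real set list \<Rightarrow> real \<Rightarrow> real \<Rightarrow> nat set" where
  "common_bars Js s t = {i. i < length Js \<and> s \<in> Js ! i \<and> t \<in> Js ! i}"

lemma finite_common_bars [simp]: "finite (common_bars Js s t)"
  unfolding common_bars_def by simp

text \<open>
  Through the two isomorphisms, the image of the structure map from \<open>s\<close> to \<open>t\<close> is the space of functions
  supported on \<open>common_bars Js s t\<close> on one side and on \<open>common_bars Js' s t\<close> on the other.
\<close>
lemma card_common_bars_le:
  fixes V :: "('k::field, 'x) persistence"
  assumes V: "persistence_closed V" and st: "s \<le> t"
    and iso1: "persistence_iso V (direct_sum (map interval_module Js) :: ('k, nat \<Rightarrow> 'k) persistence)"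
    and iso2: "persistence_iso V (direct_sum (map interval_module Js') :: ('k, nat \<Rightarrow> 'k) persistence)"
  shows "card (common_bars Js s t) \<le> card (common_bars Js' s t)"
proof -
  let ?X = "direct_sum (map interval_module Js) :: ('k, nat \<Rightarrow> 'k) persistence"
  let ?Y = "direct_sum (map interval_module Js') :: ('k, nat \<Rightarrow> 'k) persistence"
  let ?n = "length Js" and ?m = "length Js'"
  obtain \<Phi> where
    \<Phi>: "\<And>t. bij_betw (\<Phi> t) (pspace V t) (pspace ?X t)"
    and \<Phi>_add: "\<And>t x y. x \<in> pspace V t \<Longrightarrow> y \<in> pspace V t \<Longrightarrow> \<Phi> t (padd V t x y) = padd ?X t (\<Phi> t x) (\<Phi> t y)"
    and \<Phi>_scale: "\<And>t a x. x \<in> pspace V t \<Longrightarrow> \<Phi> t (pscale V t a x) = pscale ?X t a (\<Phi> t x)"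
    and \<Phi>_map: "\<And>s t x. s \<le> t \<Longrightarrow> x \<in> pspace V s \<Longrightarrow> \<Phi> t (pmap V s t x) = pmap ?X s t (\<Phi> s x)"
    using iso1 unfolding persistence_iso_def by metis
  obtain \<Psi> where
    \<Psi>: "\<And>t. bij_betw (\<Psi> t) (pspace V t) (pspace ?Y t)"
    and \<Psi>_add: "\<And>t x y. x \<in> pspace V t \<Longrightarrow> y \<in> pspace V t \<Longrightarrow> \<Psi> t (padd V t x y) = padd ?Y t (\<Psi> t x) (\<Psi> t y)"
    and \<Psi>_scale: "\<And>t a x. x \<in> pspace V t \<Longrightarrow> \<Psi> t (pscale V t a x) = pscale ?Y t a (\<Psi> t x)"
    and \<Psi>_map: "\<And>s t x. s \<le> t \<Longrightarrow> x \<in> pspace V s \<Longrightarrow> \<Psi> t (pmap V s t x) = pmap ?Y s t (\<Psi> s x)"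
    using iso2 unfolding persistence_iso_def by metis
  have V_add: "\<And>t x y. x \<in> pspace V t \<Longrightarrow> y \<in> pspace V t \<Longrightarrow> padd V t x y \<in> pspace V t"
    and V_scale: "\<And>t a x. x \<in> pspace V t \<Longrightarrow> pscale V t a x \<in> pspace V t"
    and V_map: "\<And>x. x \<in> pspace V s \<Longrightarrow> pmap V s t x \<in> pspace V t"
    using V st unfolding persistence_closed_def by blast+
  define h where "h x = restrict x {..<?n}" for x :: "nat \<Rightarrow> 'k"
  define g where "g x = inv_into (pspace V s) (\<Phi> s) (h x)" for x
  define T where "T x = (\<lambda>j. if j < ?m then \<Psi> t (pmap V s t (g x)) j else 0)" for x
  let ?I = "common_bars Js s t"
  let ?A = "{x :: nat \<Rightarrow> 'k. {i. x i \<noteq> 0} \<subseteq> ?I}"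
  have h: "h x \<in> pspace ?X s" if "x \<in> ?A" for x
    using that unfolding interval_sum_simps h_def restrict_PiE_iff by (auto simp: common_bars_def)
  have g: "g x \<in> pspace V s" "\<Phi> s (g x) = h x" if "x \<in> ?A" for x
    unfolding g_def using bij_betw_inv_into_right[OF \<Phi> h[OF that]]
      bij_betwE[OF bij_betw_inv_into[OF \<Phi>]] h[OF that] by auto
  have T: "T x j = \<Psi> t (pmap V s t (g x)) j" if "j < ?m" for x j
    using that by (simp add: T_def)
  \<comment> \<open>The functions supported on the common bars are exactly those that survive from \<open>s\<close> to \<open>t\<close> unchanged.\<close>
  have fix_h: "pmap ?X s t (h x) = h x" if "x \<in> ?A" for x
    unfolding interval_sum_simps h_def by (intro restrict_ext) (use that in \<open>auto simp: common_bars_def\<close>)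
  show ?thesis
  proof (rule card_le_if_linear_inj[where T = T])
    fix x :: "nat \<Rightarrow> 'k" assume x: "{i. x i \<noteq> 0} \<subseteq> ?I"
    have "\<Psi> t (pmap V s t (g x)) = pmap ?Y s t (\<Psi> s (g x))"
      using \<Psi>_map[OF st] g x by simp
    then show "{j. T x j \<noteq> 0} \<subseteq> common_bars Js' s t"
      by (auto simp: T_def common_bars_def interval_sum_simps split: if_splits)
  next
    show "inj_on T ?A"
    proof (rule inj_onI)
      fix x y assume x: "x \<in> ?A" and y: "y \<in> ?A" and eq: "T x = T y"
      have in_t: "pmap V s t (g x) \<in> pspace V t" "pmap V s t (g y) \<in> pspace V t"
        using V_map g x y by auto
      have "\<Psi> t (pmap V s t (g x)) \<in> pspace ?Y t" "\<Psi> t (pmap V s t (g y)) \<in> pspace ?Y t"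
        using in_t \<Psi> bij_betwE by blast+
      moreover have "\<Psi> t (pmap V s t (g x)) j = \<Psi> t (pmap V s t (g y)) j" if "j < ?m" for j
        using fun_cong[OF eq, of j] that by (simp add: T_def)
      ultimately have "\<Psi> t (pmap V s t (g x)) = \<Psi> t (pmap V s t (g y))"
        unfolding interval_sum_simps by (intro PiE_ext) auto
      then have "pmap V s t (g x) = pmap V s t (g y)"
        using in_t \<Psi>[of t] by (meson bij_betw_def inj_on_eq_iff)
      then have "h x = h y"
        using \<Phi>_map[OF st, of "g x"] \<Phi>_map[OF st, of "g y"] g[OF x] g[OF y] fix_h[OF x] fix_h[OF y]
        by simp
      show "x = y"
      proof
        fix i show "x i = y i"
        proof (cases "i < ?n")
          case True
          then show ?thesis
            using fun_cong[OF \<open>h x = h y\<close>, of i] by (simp add: h_def)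
        next
          case False
          then have "i \<notin> ?I"
            by (simp add: common_bars_def)
          then have "x i = 0" "y i = 0"
            using x y by blast+
          then show ?thesis by simp
        qed
      qed
    qed
  next
    fix x y :: "nat \<Rightarrow> 'k" assume "{i. x i \<noteq> 0} \<subseteq> ?I" "{i. y i \<noteq> 0} \<subseteq> ?I"
    then have x: "x \<in> ?A" and y: "y \<in> ?A" and xy: "(\<lambda>i. x i + y i) \<in> ?A"
      by auto force
    have "\<Phi> s (g (\<lambda>i. x i + y i)) = \<Phi> s (padd V s (g x) (g y))"
      unfolding g(2)[OF xy] \<Phi>_add[OF g(1)[OF x] g(1)[OF y]] g(2)[OF x] g(2)[OF y] interval_sum_simps
      unfolding h_def by (intro restrict_ext) simp
    then have g_add: "g (\<lambda>i. x i + y i) = padd V s (g x) (g y)"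
      using \<Phi>[of s] V_add g(1) x y xy by (meson bij_betw_def inj_on_eq_iff)
    have "\<Psi> t (pmap V s t (g (\<lambda>i. x i + y i))) j =
        \<Psi> t (pmap V s t (g x)) j + \<Psi> t (pmap V s t (g y)) j" if "j < ?m" for j
      using that unfolding \<Psi>_map[OF st g(1)[OF x]] \<Psi>_map[OF st g(1)[OF y]] \<Psi>_map[OF st V_add[OF g(1)[OF x] g(1)[OF y]]]
        g_add \<Psi>_add[OF g(1)[OF x] g(1)[OF y]] interval_sum_simps by simp
    then show "T (\<lambda>i. x i + y i) = (\<lambda>j. T x j + T y j)"
      by (auto simp: T_def)
  next
    fix a and x :: "nat \<Rightarrow> 'k" assume "{i. x i \<noteq> 0} \<subseteq> ?I"
    then have x: "x \<in> ?A" and ax: "(\<lambda>i. a * x i) \<in> ?A"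
      by auto
    have "\<Phi> s (g (\<lambda>i. a * x i)) = \<Phi> s (pscale V s a (g x))"
      unfolding g(2)[OF ax] \<Phi>_scale[OF g(1)[OF x]] g(2)[OF x] interval_sum_simps
      unfolding h_def by (intro restrict_ext) simp
    then have g_scale: "g (\<lambda>i. a * x i) = pscale V s a (g x)"
      using \<Phi>[of s] V_scale g(1) x ax by (meson bij_betw_def inj_on_eq_iff)
    have "\<Psi> t (pmap V s t (g (\<lambda>i. a * x i))) j = a * \<Psi> t (pmap V s t (g x)) j" if "j < ?m" for j
      using that unfolding \<Psi>_map[OF st g(1)[OF x]] \<Psi>_map[OF st V_scale[OF g(1)[OF x]]]
        g_scale \<Psi>_scale[OF g(1)[OF x]] interval_sum_simps by simp
    then show "T (\<lambda>i. a * x i) = (\<lambda>j. a * T x j)"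
      by (auto simp: T_def)
  qed auto
qed

lemma card_common_bars_unique:
  fixes V :: "('k::field, 'x) persistence"
  assumes "persistence_closed V" "s \<le> t" "interval_decomposition V Js" "interval_decomposition V Js'"
  shows "card (common_bars Js s t) = card (common_bars Js' s t)"
  using assms by (intro antisym card_common_bars_le[of V]) (auto simp: interval_decomposition_def)

lemma size_filter_mset_card:
  "size (filter_mset P (mset xs)) = card {i. i < length xs \<and> P (xs ! i)}"
  by (metis length_filter_conv_card mset_filter size_mset)

section \<open>From ranks to endpoints\<close>

definition endpoints :: "real set \<Rightarrow> real \<times> ereal" where
  "endpoints J = (Inf J, SUP t\<in>J. ereal t)"

text \<open>
  Up to the question of endpoints, the points whose bar contains the bar of \<open>q\<close>.
\<close>
abbreviation quadrant :: "real \<times> ereal \<Rightarrow> (real \<times> ereal) \<Rightarrow> bool" where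
  "quadrant q p \<equiv> fst p \<le> fst q \<and> snd q \<le> snd p"

text \<open>
  The quadrant of a point above the diagonal lies above the diagonal.  Hence one can induct on the number of
  points in it: all other points of the quadrant have smaller quadrants, so their multiplicities agree, and
  equality of the two sizes leaves equal multiplicities for \<open>q\<close>.
\<close>
lemma quadrant_sizes_determine_count:
  fixes P P' :: "(real \<times> ereal) multiset"
  assumes quad: "\<And>q. ereal (fst q) < snd q \<Longrightarrow>
      size (filter_mset (quadrant q) P) = size (filter_mset (quadrant q) P')"
    and "ereal (fst q) < snd q"
  shows "count P q = count P' q"
  using assms(2)
proof (induction q rule: measure_induct_rule[of "\<lambda>q. size (filter_mset (quadrant q) (P + P'))"])
  case (less q)
  show ?case
  proof (cases "q \<in># P + P'")
    case False
    then show ?thesis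
      by (simp add: not_in_iff)
  next
    case True
    let ?rest = "\<lambda>p. quadrant q p \<and> p \<noteq> q"
    have split: "filter_mset (quadrant q) R = filter_mset ?rest R + replicate_mset (count R q) q" for R
      by (rule multiset_eqI) auto
    have "count (filter_mset ?rest P) p = count (filter_mset ?rest P') p" for p
    proof (cases "?rest p \<and> p \<in># P + P'")
      case p: True
      have sub: "filter_mset (quadrant p) (P + P') \<subseteq># filter_mset ?rest (P + P')"
        unfolding multiset_filter_mono
      proof (rule mset_subset_eqI)
        fix a
        show "count (filter_mset (quadrant p) (P + P')) a \<le> count (filter_mset ?rest (P + P')) a"
          using p by (cases a, cases p, cases q) auto
      qed
      have "size (filter_mset (quadrant p) (P + P')) \<le> size (filter_mset ?rest (P + P'))"
        using sub by (rule size_mset_mono)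
      also have "\<dots> < size (filter_mset (quadrant q) (P + P'))"
        unfolding split[of "P + P'"] using True by (auto simp: count_greater_zero_iff[symmetric] simp del: count_greater_zero_iff)
      finally have "size (filter_mset (quadrant p) (P + P')) < size (filter_mset (quadrant q) (P + P'))" .
      moreover have "ereal (fst p) < snd p"
      proof -
        have "ereal (fst p) \<le> ereal (fst q)"
          using p by simp
        also have "\<dots> < snd q" by (rule less.prems)
        also have "\<dots> \<le> snd p" using p by simp
        finally show ?thesis .
      qed
      ultimately show ?thesis
        using less.IH[of p] p by auto
    next
      case False
      then show ?thesis by (auto simp: not_in_iff)
    qed
    then have "filter_mset ?rest P = filter_mset ?rest P'"
      by (rule multiset_eqI)
    then show ?thesis
      using quad[OF less.prems] unfolding split[of P] split[of P'] by simp
  qed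
qed

text \<open>
  Whether an interval contains its endpoints is invisible in the barcode.  Testing with \<open>s\<close> slightly above
  \<open>b\<close> and \<open>t\<close> slightly below \<open>d\<close> avoids this ambiguity; "slightly" means that no endpoint of \<open>J\<close> lies
  strictly between.
\<close>
lemma contains_iff_endpoints:
  assumes J: "is_interval J" "J \<noteq> {}" "bdd_below J" and st: "s \<le> t"
    and s: "b < s" "b < Inf J \<Longrightarrow> s < Inf J"
    and t: "ereal t < d" "(SUP x\<in>J. ereal x) < d \<Longrightarrow> (SUP x\<in>J. ereal x) < ereal t"
  shows "s \<in> J \<and> t \<in> J \<longleftrightarrow> Inf J \<le> b \<and> d \<le> (SUP x\<in>J. ereal x)"
proof
  assume in_J: "s \<in> J \<and> t \<in> J"
  have "Inf J \<le> s"
    using in_J J(3) cInf_lower by blast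
  moreover have "ereal t \<le> (SUP x\<in>J. ereal x)"
    using in_J by (auto intro: SUP_upper)
  ultimately show "Inf J \<le> b \<and> d \<le> (SUP x\<in>J. ereal x)"
    using s(2) t(2) by (meson leD not_le_imp_less)
next
  assume e: "Inf J \<le> b \<and> d \<le> (SUP x\<in>J. ereal x)"
  then have "Inf J < s" "ereal t < (SUP x\<in>J. ereal x)"
    using s(1) t(1) by auto
  then obtain x y where "x \<in> J" "x < s" "y \<in> J" "t < y"
    using cInf_lessD[OF J(2) \<open>Inf J < s\<close>] by (auto simp: less_SUP_iff)
  then show "s \<in> J \<and> t \<in> J"
    using J(1) st unfolding is_interval_1 by (meson less_imp_le order_trans)
qed

lemma quadrant_size_eq_common_bars:
  assumes Js: "\<And>J. J \<in> set Js \<union> set Js' \<Longrightarrow> is_interval J \<and> J \<noteq> {} \<and> bdd_below J"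
    and q: "ereal (fst q) < snd q"
  shows "\<exists>s t. s \<le> t \<and>
     size (filter_mset (quadrant q) (image_mset endpoints (mset Js))) = card (common_bars Js s t) \<and>
     size (filter_mset (quadrant q) (image_mset endpoints (mset Js'))) = card (common_bars Js' s t)"
proof -
  obtain b d where bd: "q = (b, d)" by fastforce
  let ?S = "set Js \<union> set Js'"
  \<comment> \<open>The next birth after \<open>b\<close>, capped by \<open>d\<close>, bounds the choice of \<open>s\<close>; the last death before \<open>d\<close> bounds \<open>t\<close>.\<close>
  let ?L = "insert d {ereal (Inf J) |J. J \<in> ?S \<and> b < Inf J}"
  have "finite ?L" by simp
  then have "ereal b < Min ?L"
    using q bd by (subst Min_gr_iff) auto
  then obtain s where s: "ereal b < ereal s" "ereal s < Min ?L"
    using ereal_dense2 by blast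
  have s_less: "x \<in> ?L \<Longrightarrow> ereal s < x" for x
    by (rule less_le_trans[OF s(2) Min_le[OF \<open>finite ?L\<close>]])
  let ?U = "insert (ereal s) {SUP x\<in>J. ereal x |J. J \<in> ?S \<and> (SUP x\<in>J. ereal x) < d}"
  have "finite ?U" by simp
  then have "Max ?U < d"
    using s_less by (subst Max_less_iff) auto
  then obtain t where t: "Max ?U < ereal t" "ereal t < d"
    using ereal_dense2 by blast
  have t_gr: "x \<in> ?U \<Longrightarrow> x < ereal t" for x
    by (rule le_less_trans[OF Max_ge[OF \<open>finite ?U\<close>] t(1)])
  have st: "s \<le> t"
    using t_gr[of "ereal s"] by simp
  have fits: "quadrant q (endpoints J) \<longleftrightarrow> s \<in> J \<and> t \<in> J" if "J \<in> ?S" for J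
  proof -
    have "s \<in> J \<and> t \<in> J \<longleftrightarrow> Inf J \<le> b \<and> d \<le> (SUP x\<in>J. ereal x)"
    proof (rule contains_iff_endpoints[OF _ _ _ st])
      show "s < Inf J" if "b < Inf J"
        using s_less[of "ereal (Inf J)"] that \<open>J \<in> ?S\<close> by auto
      show "(SUP x\<in>J. ereal x) < ereal t" if "(SUP x\<in>J. ereal x) < d"
        using t_gr[of "SUP x\<in>J. ereal x"] that \<open>J \<in> ?S\<close> by blast
    qed (use Js[OF that] s(1) t(2) in auto)
    then show ?thesis
      by (auto simp: endpoints_def bd)
  qed
  have "size (filter_mset (quadrant q) (image_mset endpoints (mset Xs))) = card (common_bars Xs s t)"
    if "set Xs \<subseteq> ?S" for Xs
  proof -
    have "size (filter_mset (quadrant q) (image_mset endpoints (mset Xs))) =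
        card {i. i < length Xs \<and> quadrant q (endpoints (Xs ! i))}"
      by (simp add: filter_mset_image_mset size_filter_mset_card del: mset_map)
    also have "{i. i < length Xs \<and> quadrant q (endpoints (Xs ! i))} = common_bars Xs s t"
      using that fits unfolding common_bars_def by (auto dest: nth_mem)
    finally show ?thesis .
  qed
  then show ?thesis
    using st by blast
qed

text \<open>
  The barcode is well defined: the ranks of the structure maps determine all quadrant sizes, hence all
  multiplicities above the diagonal, and the diagonal absorbs one-point intervals.  The infimum of an
  interval unbounded below has no meaning as a real number, so boundedness of one decomposition is assumed;
  it passes to the other one because the ranks vanish at early times.
\<close>
theorem barcode_unique:
  fixes V :: "('k::field, 'x) persistence"
  assumes V: "persistence_closed V"
    and Js: "interval_decomposition V Js" "\<And>J. J \<in> set Js \<Longrightarrow> bdd_below J"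
    and Js': "interval_decomposition V Js'"
  shows "with_diagonal (image_mset endpoints (mset Js)) = with_diagonal (image_mset endpoints (mset Js'))"
proof -
  have interval: "is_interval J \<and> J \<noteq> {}" if "J \<in> set Js \<union> set Js'" for J
    using that Js(1) Js' unfolding interval_decomposition_def by blast
  have rank: "card (common_bars Js s t) = card (common_bars Js' s t)" if "s \<le> t" for s t
    using card_common_bars_unique[OF V that Js(1) Js'] .
  have "bdd_below J" if J: "J \<in> set Js'" for J
  proof -
    have "\<exists>c. \<forall>J\<in>set Js. \<forall>x\<in>J. c \<le> x"
    proof -
      have "bdd_below (\<Union> (set Js))"
        using Js(2) bdd_below_UN[of "set Js" "\<lambda>J. J"] by simp
      then show ?thesis
        unfolding bdd_below_def by blast
    qed
    then obtain c where c: "\<And>J x. J \<in> set Js \<Longrightarrow> x \<in> J \<Longrightarrow> c \<le> x"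
      by blast
    \<comment> \<open>No bar of \<open>Js\<close> reaches below \<open>c\<close>, so the ranks vanish there and no bar of \<open>Js'\<close> does either.\<close>
    have "c - 1 \<le> x" if x: "x \<in> J" for x
    proof (rule ccontr)
      assume "\<not> c - 1 \<le> x"
      then have "common_bars Js x x = {}"
        using c by (force simp: common_bars_def)
      then have "common_bars Js' x x = {}"
        using rank[of x x] by (simp add: card_eq_0_iff)
      then show False
        using J x by (auto simp: common_bars_def in_set_conv_nth)
    qed
    then show ?thesis
      by (rule bdd_belowI)
  qed
  then have all: "is_interval J \<and> J \<noteq> {} \<and> bdd_below J" if "J \<in> set Js \<union> set Js'" for J
    using interval[OF that] Js(2) that by auto
  let ?P = "image_mset endpoints (mset Js)" and ?P' = "image_mset endpoints (mset Js')"
  have off_diagonal: "count ?P q = count ?P' q" if "ereal (fst q) < snd q" for q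
    using that
  proof (rule quadrant_sizes_determine_count[rotated])
    fix q :: "real \<times> ereal" assume q: "ereal (fst q) < snd q"
    have "\<exists>s t. s \<le> t \<and> size (filter_mset (quadrant q) ?P) = card (common_bars Js s t) \<and>
        size (filter_mset (quadrant q) ?P') = card (common_bars Js' s t)"
      using all q by (rule quadrant_size_eq_common_bars)
    then show "size (filter_mset (quadrant q) ?P) = size (filter_mset (quadrant q) ?P')"
      using rank by auto
  qed
  have below: "count (image_mset endpoints (mset Xs)) (b, d) = 0"
    if db: "d < ereal b" and Xs: "set Xs \<subseteq> set Js \<union> set Js'" for b d Xs
  proof -
    have "ereal (Inf J) \<le> (SUP x\<in>J. ereal x)" if J: "J \<in> set Xs" for J
    proof -
      have *: "is_interval J \<and> J \<noteq> {} \<and> bdd_below J"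
        by (rule all) (use J Xs in blast)
      obtain x where x: "x \<in> J"
        using * by blast
      then have "ereal (Inf J) \<le> ereal x"
        using * by (auto intro!: cInf_lower)
      also have "\<dots> \<le> (SUP x\<in>J. ereal x)"
        using x by (rule SUP_upper)
      finally show ?thesis .
    qed
    then show ?thesis
      using db by (force simp: not_in_iff[symmetric] endpoints_def)
  qed
  show ?thesis
  proof
    fix p :: "real \<times> ereal"
    obtain b d where p: "p = (b, d)" by fastforce
    consider "ereal b < d" | "d = ereal b" | "d < ereal b"
      by (metis not_less_iff_gr_or_eq)
    then show "with_diagonal ?P p = with_diagonal ?P' p"
    proof cases
      case 1
      then show ?thesis
        using off_diagonal[of "(b, d)"] by (simp add: with_diagonal_def p del: count_image_mset)
    next
      case 2
      then show ?thesis
        by (simp add: with_diagonal_def p)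
    next
      case 3
      then show ?thesis
        using below[of d b Js] below[of d b Js'] by (simp add: with_diagonal_def p)
    qed
  qed
qed

section \<open>Persistent homology as a subquotient\<close>

lemma chains_mono: "L \<subseteq> L' \<Longrightarrow> chains L q \<subseteq> chains L' q"
  unfolding chains_def by fast

lemma chains_support: "c \<in> chains L q \<Longrightarrow> c xs \<noteq> 0 \<Longrightarrow> length xs = Suc q \<and> distinct xs \<and> set xs \<in> L"
  unfolding chains_def by blast

lemma chains_swap:
  "c \<in> chains L q \<Longrightarrow> i < length xs \<Longrightarrow> j < length xs \<Longrightarrow> i \<noteq> j \<Longrightarrow> c (xs[i := xs ! j, j := xs ! i]) = - c xs"
  unfolding chains_def by blast

lemma chains_empty: "chains {} q = {0}"
  unfolding chains_def by (auto simp: fun_eq_iff)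

lemma subspace_chains: "fun_space.subspace (chains L q :: ('v list \<Rightarrow> 'k::field) set)"
proof (rule fun_space.subspaceI)
  show "0 \<in> (chains L q :: ('v list \<Rightarrow> 'k) set)"
    by (simp add: chains_def)
  show "c + d \<in> chains L q" if "c \<in> chains L q" "d \<in> chains L q" for c d :: "'v list \<Rightarrow> 'k"
    using that chains_support chains_swap
    unfolding chains_def[of L q] mem_Collect_eq plus_fun_apply
    by (smt (verit) add_0 minus_add_distrib add.commute)
  show "scale_fun a c \<in> chains L q" if "c \<in> chains L q" for a :: 'k and c :: "'v list \<Rightarrow> 'k"
    using that by (simp add: chains_def scale_fun_def)
qed

lemma boundary_add: "boundary K (c + d) = boundary K c + boundary K d"
  by (simp add: fun_eq_iff boundary_def sum.distrib)

lemma boundary_scale: "boundary K (scale_fun a c) = scale_fun a (boundary K c)"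
  by (simp add: fun_eq_iff boundary_def scale_fun_def sum_distrib_left)

lemma subspace_cycles: "fun_space.subspace (cycles L q :: ('v list \<Rightarrow> 'k::field) set)"
proof (rule fun_space.subspaceI)
  have zero: "(\<lambda>_. 0) = (0 :: 'v list \<Rightarrow> 'k)"
    by (simp add: zero_fun_def)
  note sub = fun_space.subspace_0[OF subspace_chains] fun_space.subspace_add[OF subspace_chains]
    fun_space.subspace_scale[OF subspace_chains]
  show "0 \<in> (cycles L q :: ('v list \<Rightarrow> 'k) set)"
    using sub(1) by (auto simp: cycles_def boundary_def fun_eq_iff)
  show "c + d \<in> cycles L q" if "c \<in> cycles L q" "d \<in> cycles L q" for c d :: "'v list \<Rightarrow> 'k"
    using that sub(2) by (auto simp: cycles_def boundary_add zero)
  show "scale_fun a c \<in> cycles L q" if "c \<in> cycles L q" for a :: 'k and c :: "'v list \<Rightarrow> 'k"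
    using that sub(3) by (auto simp: cycles_def boundary_scale zero)
qed

lemma subspace_boundaries: "fun_space.subspace (boundaries L q :: ('v list \<Rightarrow> 'k::field) set)"
proof (rule fun_space.subspaceI)
  note sub = fun_space.subspace_0[OF subspace_chains] fun_space.subspace_add[OF subspace_chains]
    fun_space.subspace_scale[OF subspace_chains]
  have "boundary L 0 = (0 :: 'v list \<Rightarrow> 'k)"
    by (simp add: boundary_def fun_eq_iff)
  then show "0 \<in> (boundaries L q :: ('v list \<Rightarrow> 'k) set)"
    using sub(1) unfolding boundaries_def by (metis imageI)
  show "c + d \<in> boundaries L q" if cd: "c \<in> boundaries L q" "d \<in> boundaries L q" for c d :: "'v list \<Rightarrow> 'k"
  proof -
    obtain x y where "x \<in> chains L (Suc q)" "y \<in> chains L (Suc q)" "c = boundary L x" "d = boundary L y"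
      using cd unfolding boundaries_def by blast
    then show ?thesis
      unfolding boundaries_def by (metis boundary_add imageI sub(2))
  qed
  show "scale_fun a c \<in> boundaries L q" if c: "c \<in> boundaries L q" for a :: 'k and c :: "'v list \<Rightarrow> 'k"
  proof -
    obtain x where "x \<in> chains L (Suc q)" "c = boundary L x"
      using c unfolding boundaries_def by blast
    then show ?thesis
      unfolding boundaries_def by (metis boundary_scale imageI sub(3))
  qed
qed

text \<open>
  The sum in the boundary ranges over the vertices of the complex, but only vertices of the support
  contribute.
\<close>
lemma boundary_mono:
  assumes "c \<in> chains L q" "L \<subseteq> L'" "finite (\<Union>L')"
  shows "boundary L c = boundary L' c"
proof
  fix ys
  have "(\<Sum>v\<in>\<Union>L. c (v # ys)) = (\<Sum>v\<in>\<Union>L'. c (v # ys))"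
    using assms(2,3) chains_support[OF assms(1)]
    by (intro sum.mono_neutral_left) (auto, force)
  then show "boundary L c ys = boundary L' c ys"
    by (simp add: boundary_def)
qed

lemma cycles_mono:
  assumes "L \<subseteq> L'" "finite (\<Union>L')"
  shows "cycles L q \<subseteq> cycles L' q"
proof
  fix c assume "c \<in> cycles L q"
  then have c: "c \<in> chains L q" "boundary L c = (\<lambda>_. 0)"
    by (auto simp: cycles_def)
  then show "c \<in> cycles L' q"
    using boundary_mono[OF c(1) assms] chains_mono[OF assms(1)] by (auto simp: cycles_def)
qed

lemma boundaries_mono:
  assumes "L \<subseteq> L'" "finite (\<Union>L')"
  shows "boundaries L q \<subseteq> boundaries L' q"
proof
  fix b assume "b \<in> boundaries L q"
  then obtain c where c: "c \<in> chains L (Suc q)" "b = boundary L c"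
    by (auto simp: boundaries_def)
  then show "b \<in> boundaries L' q"
    using boundary_mono[OF c(1) assms] chains_mono[OF assms(1)] by (auto simp: boundaries_def)
qed

lemma boundary_in_chains:
  assumes L: "abstract_simplicial_complex L" and c: "c \<in> chains L (Suc q)"
  shows "boundary L c \<in> chains L q"
  unfolding chains_def
proof (intro CollectI conjI allI impI)
  fix ys assume nz: "boundary L c ys \<noteq> 0"
  then have ys: "ys \<noteq> []"
    by (auto simp: boundary_def)
  then obtain v where "c (v # ys) \<noteq> 0"
    using nz sum.neutral[of "\<Union>L" "\<lambda>v. c (v # ys)"] by (auto simp: boundary_def)
  then have v: "length ys = Suc q" "distinct ys" "set (v # ys) \<in> L"
    using chains_support[OF c] by fastforce+
  then show "length ys = Suc q" "distinct ys"
    by auto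
  have "set ys \<subseteq> set (v # ys)" "set ys \<noteq> {}"
    using ys by auto
  then show "set ys \<in> L"
    using L v(3) unfolding abstract_simplicial_complex_def by blast
next
  fix ys :: "'a list" and i j assume "i < length ys \<and> j < length ys \<and> i \<noteq> j"
  then have "c (v # ys[i := ys ! j, j := ys ! i]) = - c (v # ys)" for v
    using chains_swap[OF c, of "Suc i" "v # ys" "Suc j"] by simp
  then show "boundary L c (ys[i := ys ! j, j := ys ! i]) = - boundary L c ys"
    by (simp add: boundary_def sum_negf)
qed

text \<open>
  Antisymmetry alone gives only that twice the sum vanishes, which is void in characteristic 2; therefore the
  vanishing diagonal is a separate assumption.
\<close>
lemma sum_alternating_eq_0:
  fixes a :: "'i \<Rightarrow> 'i \<Rightarrow> 'k::ab_group_add"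
  assumes "\<And>v w. a v w = - a w v" "\<And>v. a v v = 0"
  shows "(\<Sum>v\<in>A. \<Sum>w\<in>A. a v w) = 0"
proof (induction A rule: infinite_finite_induct)
  case (insert x A)
  have "(\<Sum>v\<in>A. a v x) = - (\<Sum>w\<in>A. a x w)"
    unfolding sum_negf[symmetric] by (intro sum.cong refl assms(1))
  then show ?case
    using insert assms(2) by (simp add: sum.distrib)
qed auto

lemma boundary_boundary:
  assumes c: "c \<in> chains L q"
  shows "boundary L (boundary L c) = (\<lambda>_. 0)"
proof
  fix ys
  have "(\<Sum>v\<in>\<Union>L. \<Sum>w\<in>\<Union>L. c (w # v # ys)) = 0"
  proof (rule sum_alternating_eq_0)
    show "c (w # v # ys) = - c (v # w # ys)" for v w
      using chains_swap[OF c, of 0 "v # w # ys" 1] by simp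
    show "c (v # v # ys) = 0" for v
      using chains_support[OF c, of "v # v # ys"] by auto
  qed
  then show "boundary L (boundary L c) ys = 0"
    by (simp add: boundary_def)
qed

lemma boundaries_subset_cycles:
  assumes "abstract_simplicial_complex L"
  shows "boundaries L q \<subseteq> cycles L q"
proof
  fix b assume "b \<in> boundaries L q"
  then obtain c where c: "c \<in> chains L (Suc q)" "b = boundary L c"
    by (auto simp: boundaries_def)
  then show "b \<in> cycles L q"
    using boundary_in_chains[OF assms c(1)] boundary_boundary[OF c(1)] by (simp add: cycles_def)
qed

lemma persistent_homology_eq_subquotient:
  fixes K :: "'v set set"
  shows "(persistent_homology p K f :: ('k::field, ('v list \<Rightarrow> 'k) set) persistence) =
     subquotient scale_fun (\<lambda>t. cycles (sublevel K f t) p) (\<lambda>t. boundaries (sublevel K f t) p)"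
proof -
  have "homology_class L p = (coset (boundaries L p) :: ('v list \<Rightarrow> 'k) \<Rightarrow> _)" for L :: "'v set set"
    by (auto simp: fun_eq_iff homology_class_def coset_def plus_fun_def)
  then show ?thesis
    by (simp add: persistent_homology_def subquotient_def plus_fun_def scale_fun_def)
qed

lemma complex_sublevel:
  assumes K: "abstract_simplicial_complex K" and f: "filter_function K f"
  shows "abstract_simplicial_complex (sublevel K f t)"
  unfolding abstract_simplicial_complex_def
proof (intro conjI ballI allI impI)
  fix \<sigma> assume \<sigma>: "\<sigma> \<in> sublevel K f t"
  then have "\<sigma> \<in> K" "f \<sigma> \<le> t"
    by (auto simp: sublevel_def)
  then show "finite \<sigma>" "\<sigma> \<noteq> {}"
    using K unfolding abstract_simplicial_complex_def by auto
  fix \<tau> assume \<tau>: "\<tau> \<subseteq> \<sigma> \<and> \<tau> \<noteq> {}"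
  then have "\<tau> \<in> K"
    using K \<open>\<sigma> \<in> K\<close> unfolding abstract_simplicial_complex_def by blast
  moreover have "f \<tau> \<le> f \<sigma>"
    using f \<tau> \<open>\<tau> \<in> K\<close> \<open>\<sigma> \<in> K\<close> unfolding filter_function_def by blast
  ultimately show "\<tau> \<in> sublevel K f t"
    using \<open>f \<sigma> \<le> t\<close> by (simp add: sublevel_def)
qed

lemma sublevel_mono: "s \<le> t \<Longrightarrow> sublevel K f s \<subseteq> sublevel K f t"
  by (auto simp: sublevel_def)

lemma sublevel_subset: "sublevel K f t \<subseteq> K"
  by (auto simp: sublevel_def)

lemma finite_vertices: "abstract_simplicial_complex K \<Longrightarrow> finite K \<Longrightarrow> L \<subseteq> K \<Longrightarrow> finite (\<Union>L)"
  by (meson abstract_simplicial_complex_def finite_Union finite_subset subsetD)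

lemma filtered_subquotient_homology:
  assumes "abstract_simplicial_complex K" "finite K" "filter_function K f"
  shows "filtered_subquotient scale_fun
     (\<lambda>t. cycles (sublevel K f t) p :: ('v list \<Rightarrow> 'k::field) set) (\<lambda>t. boundaries (sublevel K f t) p)"
proof (intro filtered_subquotient.intro filtered_subquotient_axioms.intro)
  show "vector_space (scale_fun :: 'k \<Rightarrow> ('v list \<Rightarrow> 'k) \<Rightarrow> _)"
    by (rule fun_space.vector_space_axioms)
qed (rule subspace_cycles subspace_boundaries boundaries_subset_cycles[OF complex_sublevel[OF assms(1,3)]]
    cycles_mono[OF sublevel_mono finite_vertices[OF assms(1,2) sublevel_subset]]
    boundaries_mono[OF sublevel_mono finite_vertices[OF assms(1,2) sublevel_subset]] | assumption)+

lemma finite_independent_chains: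
  assumes "finite (\<Union>K)" and E: "fun_space.independent E" "E \<subseteq> chains K q"
  shows "finite (E :: ('v list \<Rightarrow> 'k::field) set)"
proof -
  let ?X = "{xs. set xs \<subseteq> \<Union>K \<and> length xs = Suc q}"
  have X: "finite ?X"
    using assms(1) by (rule finite_lists_length_eq)
  have "E \<subseteq> fun_space.span (delta ` ?X)"
    using E(2) chains_support by (intro subsetI in_span_delta[OF X]) blast
  then show ?thesis
    using fun_space.independent_span_bound[OF finite_imageI[OF X] E(1)] by blast
qed

section \<open>The barcode on an ordering stratum\<close>

lemma sublevel_ordering_equiv:
  assumes "(f, g) \<in> ordering_equiv K" "\<sigma> \<in> K"
  shows "sublevel K g (g \<sigma>) = sublevel K f (f \<sigma>)"
  using assms unfolding ordering_equiv_def sublevel_def by auto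

lemma sublevel_cases:
  assumes "finite K" and fg: "(f, g) \<in> ordering_equiv K"
  obtains "sublevel K g t = {}"
  | \<sigma> where "\<sigma> \<in> K" "g \<sigma> \<le> t" "sublevel K g t = sublevel K f (f \<sigma>)"
proof (cases "sublevel K g t = {}")
  case False
  have "finite (sublevel K g t)"
    using assms(1) by (simp add: sublevel_def)
  then have "Max (g ` sublevel K g t) \<in> g ` sublevel K g t"
    using False by (intro Max_in) auto
  then obtain \<sigma> where \<sigma>: "\<sigma> \<in> sublevel K g t" "g \<sigma> = Max (g ` sublevel K g t)"
    by auto
  have "sublevel K g t = sublevel K g (g \<sigma>)"
    using \<sigma> \<open>finite (sublevel K g t)\<close> by (auto simp: sublevel_def)
  then show ?thesis
    using that(2)[of \<sigma>] \<sigma>(1) sublevel_ordering_equiv[OF fg] by (auto simp: sublevel_def)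
qed (use that in blast)

text \<open>
  Functions with the same ordering have the same sublevel sets, reached at different times.  So the first
  time at which a monotone condition on the sublevel set holds is attained at a simplex that does not depend
  on the function within the ordering class.  The condition has to fail on the empty complex, which is the
  sublevel set at all early times.
\<close>
lemma entry_time:
  fixes C :: "'v set set \<Rightarrow> 'c set"
  assumes "finite K" and mono: "\<And>L L'. L \<subseteq> L' \<Longrightarrow> L' \<subseteq> K \<Longrightarrow> C L \<subseteq> C L'" and "e \<notin> C {}"
  shows "(\<exists>\<sigma>\<in>K. \<forall>g. (f, g) \<in> ordering_equiv K \<longrightarrow> {t. e \<in> C (sublevel K g t)} = {g \<sigma>..}) \<or>
         (\<forall>g. (f, g) \<in> ordering_equiv K \<longrightarrow> {t. e \<in> C (sublevel K g t)} = {})"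
proof (cases "\<exists>\<sigma>\<in>K. e \<in> C (sublevel K f (f \<sigma>))")
  case True
  let ?S = "{\<sigma> \<in> K. e \<in> C (sublevel K f (f \<sigma>))}"
  have "finite ?S" "?S \<noteq> {}"
    using assms(1) True by auto
  then obtain \<sigma> where \<sigma>: "\<sigma> \<in> ?S" "\<And>\<rho>. \<rho> \<in> ?S \<Longrightarrow> f \<sigma> \<le> f \<rho>"
    using arg_min_if_finite[of ?S f] by (meson linorder_not_le)
  have "{t. e \<in> C (sublevel K g t)} = {g \<sigma>..}" if fg: "(f, g) \<in> ordering_equiv K" for g
  proof (intro equalityI subsetI)
    fix t assume "t \<in> {t. e \<in> C (sublevel K g t)}"
    then have t: "e \<in> C (sublevel K g t)" by simp
    from assms(1) fg show "t \<in> {g \<sigma>..}"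
    proof (cases rule: sublevel_cases[where t = t])
      case 1
      then show ?thesis using t assms(3) by simp
    next
      case (2 \<rho>)
      then have "f \<sigma> \<le> f \<rho>"
        using \<sigma>(2) t by simp
      then have "g \<sigma> \<le> g \<rho>"
        using fg \<sigma>(1) 2(1) unfolding ordering_equiv_def by auto
      then show ?thesis using 2 by simp
    qed
  next
    fix t assume "t \<in> {g \<sigma>..}"
    then have "sublevel K f (f \<sigma>) \<subseteq> sublevel K g t"
      using sublevel_ordering_equiv[OF fg, of \<sigma>] \<sigma>(1) sublevel_mono[of "g \<sigma>" t K g] by simp
    then show "t \<in> {t. e \<in> C (sublevel K g t)}"
      using \<sigma>(1) mono[OF _ sublevel_subset] by blast
  qed
  then show ?thesis using \<sigma>(1) by blast
next
  case False
  have "e \<notin> C (sublevel K g t)" if fg: "(f, g) \<in> ordering_equiv K" for g t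
    using assms(1) fg by (cases rule: sublevel_cases[where t = t]) (use False assms(3) in auto)
  then show ?thesis by blast
qed

text \<open>
  The cycles and the boundaries of the sublevel sets of \<open>f\<close> are two flags in one chain space, and they are
  the same two flags for every \<open>g\<close> ordering equivalent to \<open>f\<close>.  A basis adapted to both is thus chosen once
  for all \<open>g\<close>.  A basis vector becomes a cycle at the value of a simplex \<open>\<beta> e\<close> and a boundary at the value of
  a simplex \<open>\<tau> e\<close>, or never becomes a boundary.
\<close>
theorem persistence_pairing:
  fixes K :: "'v set set" and p :: nat
  assumes K: "abstract_simplicial_complex K" "finite K"
  shows "\<exists>ps us. set ps \<subseteq> K \<times> K \<and> set us \<subseteq> K \<and>
    (\<forall>g. (f, g) \<in> ordering_equiv K \<longrightarrow> filter_function K g \<longrightarrow>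
       interval_decomposition
         (persistent_homology p K g :: ('k::field, ('v list \<Rightarrow> 'k) set) persistence)
         (map (\<lambda>(\<sigma>, \<tau>). {g \<sigma>..<g \<tau>}) ps @ map (\<lambda>\<sigma>. {g \<sigma>..}) us))"
proof (cases "\<exists>g. (f, g) \<in> ordering_equiv K")
  case False
  then show ?thesis
    by (intro exI[of _ "[]"]) auto
next
  case True
  define Z where "Z L = (cycles L p :: ('v list \<Rightarrow> 'k) set)" for L :: "'v set set"
  define B where "B L = (boundaries L p :: ('v list \<Rightarrow> 'k) set)" for L :: "'v set set"
  let ?S = "\<lambda>a. sublevel K f a"
  have fin: "finite (\<Union>L)" if "L \<subseteq> K" for L
    using finite_vertices[OF K that] .
  have monoZ: "Z L \<subseteq> Z L'" and monoB: "B L \<subseteq> B L'" if "L \<subseteq> L'" "L' \<subseteq> K" for L L'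
    unfolding Z_def B_def
    by (rule cycles_mono[OF that(1) fin[OF that(2)]] boundaries_mono[OF that(1) fin[OF that(2)]])+
  have subZ: "fun_space.subspace (Z L)" and subB: "fun_space.subspace (B L)" for L
    unfolding Z_def B_def by (rule subspace_cycles subspace_boundaries)+
  have Z0: "Z {} = {0}"
    using fun_space.subspace_0[OF subspace_cycles, of "{}" p]
    by (auto simp: Z_def cycles_def chains_empty)
  have B0: "B {} = {0}"
    using fun_space.subspace_0[OF subspace_boundaries, of "{}" p]
    by (auto simp: B_def boundaries_def chains_empty boundary_def fun_eq_iff)
  have "\<exists>E. fun_space.independent E \<and> E \<subseteq> (\<Union>a\<in>f ` K. Z (?S a)) \<and>
      (\<forall>a\<in>f ` K. Z (?S a) \<subseteq> fun_space.span (E \<inter> Z (?S a))) \<and>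
      (\<forall>a\<in>f ` K. fun_space.span E \<inter> B (?S a) \<subseteq> fun_space.span (E \<inter> B (?S a)))"
    by (rule fun_space.adapted_basis)
      (rule finite_imageI K(2) subZ subB monoZ[OF sublevel_mono sublevel_subset]
        monoB[OF sublevel_mono sublevel_subset] | assumption)+
  then obtain E where E: "fun_space.independent E" "E \<subseteq> (\<Union>a\<in>f ` K. Z (?S a))"
    and EZ: "\<And>\<sigma>. \<sigma> \<in> K \<Longrightarrow> Z (?S (f \<sigma>)) \<subseteq> fun_space.span (E \<inter> Z (?S (f \<sigma>)))"
    and EB': "\<And>\<sigma>. \<sigma> \<in> K \<Longrightarrow> fun_space.span E \<inter> B (?S (f \<sigma>)) \<subseteq> fun_space.span (E \<inter> B (?S (f \<sigma>)))"
    by blast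
  have "E \<subseteq> chains K p"
    using E(2) monoZ[OF sublevel_subset] by (fastforce simp: Z_def cycles_def)
  then have "finite E"
    using finite_independent_chains[OF fin E(1)] by blast
  then obtain es where es: "distinct es" "set es = E"
    using finite_distinct_list by blast
  have "0 \<notin> E"
    using E(1) fun_space.dependent_zero by blast
  define enters where "enters C e \<sigma> \<longleftrightarrow> \<sigma> \<in> K \<and>
    (\<forall>g. (f, g) \<in> ordering_equiv K \<longrightarrow> {t. e \<in> C (sublevel K g t)} = {g \<sigma>..})"
    for C :: "'v set set \<Rightarrow> ('v list \<Rightarrow> 'k) set" and e \<sigma>
  have "\<exists>\<sigma>. enters Z e \<sigma>" if e: "e \<in> E" for e
  proof -
    have "e \<notin> Z {}"
      using Z0 e \<open>0 \<notin> E\<close> by auto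
    moreover have "(f, f) \<in> ordering_equiv K"
      using True by (auto simp: ordering_equiv_def)
    moreover have "{t. e \<in> Z (sublevel K f t)} \<noteq> {}"
      using e E(2) by blast
    ultimately show ?thesis
      using entry_time[where C = Z and f = f, OF K(2) monoZ] unfolding enters_def by blast
  qed
  define \<beta> where "\<beta> e = (SOME \<sigma>. enters Z e \<sigma>)" for e
  define \<tau> where "\<tau> e = (SOME \<sigma>. enters B e \<sigma>)" for e
  define dies where "dies e \<longleftrightarrow> (\<exists>\<sigma>. enters B e \<sigma>)" for e
  have "enters Z e (\<beta> e)" if "e \<in> E" for e
    unfolding \<beta>_def by (rule someI_ex) (fact \<open>\<And>e. e \<in> E \<Longrightarrow> \<exists>\<sigma>. enters Z e \<sigma>\<close>[OF that])
  then have \<beta>: "\<And>e. e \<in> E \<Longrightarrow> \<beta> e \<in> K"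
    "\<And>e g. e \<in> E \<Longrightarrow> (f, g) \<in> ordering_equiv K \<Longrightarrow> {t. e \<in> Z (sublevel K g t)} = {g (\<beta> e)..}"
    unfolding enters_def by simp_all
  have "enters B e (\<tau> e)" if "dies e" for e
    unfolding \<tau>_def by (rule someI_ex) (use that dies_def in simp)
  then have \<tau>: "\<And>e. dies e \<Longrightarrow> \<tau> e \<in> K"
    "\<And>e g. dies e \<Longrightarrow> (f, g) \<in> ordering_equiv K \<Longrightarrow> {t. e \<in> B (sublevel K g t)} = {g (\<tau> e)..}"
    unfolding enters_def by simp_all
  have undying: "{t. e \<in> B (sublevel K g t)} = {}"
    if "e \<in> E" "\<not> dies e" "(f, g) \<in> ordering_equiv K" for e g
  proof -
    have "e \<notin> B {}"
      using B0 that(1) \<open>0 \<notin> E\<close> by auto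
    then show ?thesis
      using entry_time[where C = B and f = f, OF K(2) monoB] that(2,3) unfolding dies_def enters_def by blast
  qed
  \<comment> \<open>A vector that is a cycle and a boundary from the same time on never shows up in homology.\<close>
  define es1 where "es1 = filter (\<lambda>e. dies e \<and> f (\<beta> e) < f (\<tau> e)) es"
  define es2 where "es2 = filter (\<lambda>e. \<not> dies e) es"
  define ps where "ps = map (\<lambda>e. (\<beta> e, \<tau> e)) es1"
  define us where "us = map \<beta> es2"
  have "set ps \<subseteq> K \<times> K" "set us \<subseteq> K"
    using \<beta>(1) \<tau>(1) es(2) by (auto simp: ps_def us_def es1_def es2_def)
  moreover have "interval_decomposition
      (persistent_homology p K g :: ('k, ('v list \<Rightarrow> 'k) set) persistence)
      (map (\<lambda>(\<sigma>, \<tau>). {g \<sigma>..<g \<tau>}) ps @ map (\<lambda>\<sigma>. {g \<sigma>..}) us)"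
    if fg: "(f, g) \<in> ordering_equiv K" and g: "filter_function K g" for g
  proof -
    interpret H: filtered_subquotient scale_fun "\<lambda>t. Z (sublevel K g t)" "\<lambda>t. B (sublevel K g t)"
      unfolding Z_def B_def using filtered_subquotient_homology[OF K g] .
    have life1: "H.lifespan e = {g (\<beta> e)..<g (\<tau> e)}" if "e \<in> E" "dies e" for e
    proof -
      have "H.lifespan e = {t. e \<in> Z (sublevel K g t)} - {t. e \<in> B (sublevel K g t)}"
        by (auto simp: H.lifespan_def)
      also have "\<dots> = {g (\<beta> e)..<g (\<tau> e)}"
        unfolding \<beta>(2)[OF that(1) fg] \<tau>(2)[OF that(2) fg] by auto
      finally show ?thesis .
    qed
    have life2: "H.lifespan e = {g (\<beta> e)..}" if "e \<in> E" "\<not> dies e" for e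
    proof -
      have "H.lifespan e = {t. e \<in> Z (sublevel K g t)} - {t. e \<in> B (sublevel K g t)}"
        by (auto simp: H.lifespan_def)
      then show ?thesis
        unfolding \<beta>(2)[OF that(1) fg] undying[OF that fg] by auto
    qed
    \<comment> \<open>Whether a lifespan is empty does not depend on \<open>g\<close>, so the filtering by \<open>f\<close> suits every \<open>g\<close>.\<close>
    have order: "f (\<beta> e) < f (\<tau> e) \<longleftrightarrow> g (\<beta> e) < g (\<tau> e)" if "e \<in> E" "dies e" for e
      using fg \<beta>(1)[OF that(1)] \<tau>(1)[OF that(2)] unfolding ordering_equiv_def
      by (auto simp: not_le[symmetric])
    have "interval_decomposition H.V (map H.lifespan (es1 @ es2))"
    proof (rule H.adapted_basis_decomposition[OF E(1)])
      show "Z (sublevel K g t) \<subseteq> fun_space.span (E \<inter> Z (sublevel K g t))" for t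
        using K(2) fg by (cases rule: sublevel_cases[where t = t])
          (use EZ Z0 fun_space.span_zero in auto)
      show "B (sublevel K g t) \<subseteq> fun_space.span (E \<inter> B (sublevel K g t))" for t
        using K(2) fg
      proof (cases rule: sublevel_cases[where t = t])
        case 1
        then show ?thesis using B0 fun_space.span_zero by simp
      next
        case (2 \<sigma>)
        have "B (sublevel K g t) \<subseteq> fun_space.span E"
          using H.BZ[of t] EZ[OF 2(1)] fun_space.span_mono[of "E \<inter> Z (?S (f \<sigma>))" E] 2(3) by auto
        then show ?thesis
          using EB'[OF 2(1)] 2(3) by auto
      qed
      show "distinct (es1 @ es2)"
        using es(1) by (auto simp: es1_def es2_def)
      show "set (es1 @ es2) = {e \<in> E. H.lifespan e \<noteq> {}}"
        using es(2) life1 life2 order by (auto simp: es1_def es2_def)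
    qed
    moreover have "map H.lifespan (es1 @ es2) = map (\<lambda>(\<sigma>, \<tau>). {g \<sigma>..<g \<tau>}) ps @ map (\<lambda>\<sigma>. {g \<sigma>..}) us"
      using life1 life2 es(2) by (auto simp: ps_def us_def es1_def es2_def)
    ultimately show ?thesis
      unfolding persistent_homology_eq_subquotient Z_def B_def by simp
  qed
  ultimately show ?thesis
    by blast
qed

lemma endpoints_bounded:
  assumes "a < b"
  shows "endpoints {a..<b} = (a, ereal b)"
proof -
  have "(SUP t\<in>{a..<b}. ereal t) = ereal b"
  proof (rule SUP_eqI)
    fix y assume y: "\<And>t. t \<in> {a..<b} \<Longrightarrow> ereal t \<le> y"
    show "ereal b \<le> y"
    proof (rule ccontr)
      assume "\<not> ereal b \<le> y"
      then obtain z where z: "max y (ereal a) < ereal z" "ereal z < ereal b"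
        using ereal_dense2[of "max y (ereal a)" "ereal b"] \<open>a < b\<close> by (auto simp: not_le)
      then show False
        using y[of z] by auto
    qed
  qed auto
  then show ?thesis
    using assms by (simp add: endpoints_def)
qed

lemma endpoints_unbounded: "endpoints {a..} = (a, \<infinity>)"
proof -
  have "(SUP t\<in>{a..}. ereal t) = \<infinity>"
    by (rule SUP_PInfty) (metis atLeast_iff ereal_less_eq(3) max.cobounded1 max.cobounded2)
  then show ?thesis
    by (simp add: endpoints_def)
qed

lemma mset_eq_image_nth: "mset (map h xs) = image_mset (\<lambda>i. h (xs ! i)) (mset_set {..<length xs})"
proof -
  have "map h xs = map (\<lambda>i. h (xs ! i)) [0..<length xs]"
    by (rule nth_equalityI) auto
  then show ?thesis
    by (simp only: mset_map mset_upt lessThan_atLeast0)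
qed

text \<open>
  On an ordering stratum the barcode is \<^const>\<open>Q\<close> applied to values of the function at fixed simplices.  The
  coordinates of \<^const>\<open>Q\<close> alternate between births and deaths, hence the case distinction on parity.
\<close>
theorem Dgm_on_ordering_stratum:
  fixes K :: "'v set set" and p :: nat
  assumes K: "abstract_simplicial_complex K" "finite K"
  shows "\<exists>ps us. set ps \<subseteq> K \<times> K \<and> set us \<subseteq> K \<and>
    (\<forall>g. (f, g) \<in> ordering_equiv K \<longrightarrow> filter_function K g \<longrightarrow>
       Dgm TYPE('k::field) p K g = Q (length ps) (length us)
         (\<lambda>k. if even k then g (fst (ps ! (k div 2))) else g (snd (ps ! (k div 2))), \<lambda>j. g (us ! j)))"
proof -
  obtain ps us where pu: "set ps \<subseteq> K \<times> K" "set us \<subseteq> K"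
    and dec: "\<And>g. (f, g) \<in> ordering_equiv K \<Longrightarrow> filter_function K g \<Longrightarrow>
       interval_decomposition
         (persistent_homology p K g :: ('k, ('v list \<Rightarrow> 'k) set) persistence)
         (map (\<lambda>(\<sigma>, \<tau>). {g \<sigma>..<g \<tau>}) ps @ map (\<lambda>\<sigma>. {g \<sigma>..}) us)"
    using persistence_pairing[OF K, of f p, where ?'k = 'k] by blast
  have "Dgm TYPE('k) p K g = Q (length ps) (length us)
      (\<lambda>k. if even k then g (fst (ps ! (k div 2))) else g (snd (ps ! (k div 2))), \<lambda>j. g (us ! j))"
    if fg: "(f, g) \<in> ordering_equiv K" and g: "filter_function K g" for g
  proof -
    let ?V = "persistent_homology p K g :: ('k, ('v list \<Rightarrow> 'k) set) persistence"
    let ?Js = "map (\<lambda>(\<sigma>, \<tau>). {g \<sigma>..<g \<tau>}) ps @ map (\<lambda>\<sigma>. {g \<sigma>..}) us"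
    have Js: "interval_decomposition ?V ?Js"
      using dec[OF fg g] .
    have bdd: "bdd_below J" if "J \<in> set ?Js" for J
      using that by (auto intro: bdd_below_Ico)
    have closed: "persistence_closed ?V"
      unfolding persistent_homology_eq_subquotient
      by (rule filtered_subquotient.persistence_closed_V[OF filtered_subquotient_homology[OF K g]])
    have "Dgm TYPE('k) p K g = with_diagonal (image_mset endpoints (mset ?Js))"
      unfolding Dgm_def endpoints_def[symmetric]
    proof (rule the_equality)
      show "\<exists>Js. interval_decomposition ?V Js \<and>
          with_diagonal (image_mset endpoints (mset ?Js)) = with_diagonal (image_mset endpoints (mset Js))"
        using Js by blast
    next
      fix D assume "\<exists>Js. interval_decomposition ?V Js \<and> D = with_diagonal (image_mset endpoints (mset Js))"
      then show "D = with_diagonal (image_mset endpoints (mset ?Js))"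
        using barcode_unique[OF closed Js bdd] by metis
    qed
    also have "image_mset endpoints (mset ?Js) =
        mset (map (\<lambda>(\<sigma>, \<tau>). (g \<sigma>, ereal (g \<tau>))) ps) + mset (map (\<lambda>\<sigma>. (g \<sigma>, \<infinity>)) us)"
    proof -
      have "g \<sigma> < g \<tau>" if "(\<sigma>, \<tau>) \<in> set ps" for \<sigma> \<tau>
      proof -
        have "{g \<sigma>..<g \<tau>} \<in> set ?Js"
          using that by force
        then have "{g \<sigma>..<g \<tau>} \<noteq> {}"
          using Js unfolding interval_decomposition_def by blast
        then show ?thesis by simp
      qed
      then have "map endpoints ?Js =
          map (\<lambda>(\<sigma>, \<tau>). (g \<sigma>, ereal (g \<tau>))) ps @ map (\<lambda>\<sigma>. (g \<sigma>, \<infinity>)) us"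
        by (auto simp: endpoints_bounded endpoints_unbounded)
      then show ?thesis
        by (metis mset_append mset_map)
    qed
    also have "with_diagonal \<dots> = Q (length ps) (length us)
      (\<lambda>k. if even k then g (fst (ps ! (k div 2))) else g (snd (ps ! (k div 2))), \<lambda>j. g (us ! j))"
      unfolding Q_def mset_eq_image_nth by (simp add: case_prod_beta)
    finally show ?thesis .
  qed
  then show ?thesis
    using pu by blast
qed

section \<open>Differentiability along strata\<close>

lemma Q_in_Bar: "Q m n uv \<in> Bar"
proof -
  obtain u v where "uv = (u, v)" by fastforce
  then show ?thesis
    unfolding Q_def Bar_def by force
qed

lemma Cr_subset: "Cr n r W g \<Longrightarrow> W' \<subseteq> W \<Longrightarrow> Cr n r W' g"
proof (induction r arbitrary: g)
  case 0
  then show ?case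
    using continuous_map_from_subtopology_mono by auto
next
  case (Suc r)
  have "\<exists>g'. (\<forall>x\<in>W'. ((\<lambda>t. g (x(i := t))) has_real_derivative g' x) (at (x i))) \<and> Cr n r W' g'"
    if i: "i < n" for i
  proof -
    obtain g' where "\<forall>x\<in>W. ((\<lambda>t. g (x(i := t))) has_real_derivative g' x) (at (x i))" "Cr n r W g'"
      using Suc.prems(1) i by auto
    then show ?thesis
      using Suc.IH[of g'] Suc.prems(2) by blast
  qed
  moreover have "continuous_map (subtopology (Euclidean_space n) W') euclideanreal g"
    using Suc.prems continuous_map_from_subtopology_mono by auto
  ultimately show ?case by simp
qed

lemma Cr_map_subset:
  assumes "Cr_map M r U I G" "U' \<subseteq> U"
  shows "Cr_map M r U' I G"
  unfolding Cr_map_def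
proof clarify
  fix i V \<phi> assume "i \<in> I" "(V, \<phi>) \<in> smooth_charts M"
  then have "Cr (mdim M) r (\<phi> ` (U \<inter> V)) (\<lambda>x. G (inv_into V \<phi> x) i)"
    using assms(1) unfolding Cr_map_def by blast
  then show "Cr (mdim M) r (\<phi> ` (U' \<inter> V)) (\<lambda>x. G (inv_into V \<phi> x) i)"
    by (rule Cr_subset) (use assms(2) in blast)
qed

lemma Cr_map_reindex:
  assumes "Cr_map M r U K G" "h ` I \<subseteq> K"
  shows "Cr_map M r U I (\<lambda>x i. G x (h i))"
  using assms unfolding Cr_map_def by fast

text \<open>
  A slice chart of full dimension maps \<open>U \<inter> N\<close> onto the whole image of \<open>U\<close>, so \<open>U\<close> lies in \<open>N\<close>.
\<close>
lemma top_dim_submanifold_open: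
  assumes N: "submanifold M (mdim M) N"
  shows "openin (mtop M) N"
proof (subst openin_subopen, intro ballI)
  fix x assume x: "x \<in> N"
  obtain U \<phi> where c: "(U, \<phi>) \<in> slice_charts M (mdim M) N" "x \<in> U"
    using N x unfolding submanifold_def by blast
  then have chart: "is_chart (mtop M) (mdim M) (U, \<phi>)"
    and slice: "\<phi> ` (U \<inter> N) = \<phi> ` U \<inter> topspace (Euclidean_space (mdim M))"
    by (auto simp: slice_charts_def smooth_charts_def)
  have U: "openin (mtop M) U" "openin (Euclidean_space (mdim M)) (\<phi> ` U)"
    and hom: "homeomorphic_map (subtopology (mtop M) U) (subtopology (Euclidean_space (mdim M)) (\<phi> ` U)) \<phi>"
    using chart by (auto simp: is_chart_def)
  have "inj_on \<phi> U"
    using homeomorphic_imp_injective_map[OF hom] openin_subset[OF U(1)]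
    by (simp add: Int_absorb1)
  moreover have "\<phi> ` (U \<inter> N) = \<phi> ` U"
    using slice openin_subset[OF U(2)] by blast
  ultimately have "U \<inter> N = U"
    by (simp add: inj_on_image_eq_iff)
  then show "\<exists>T. openin (mtop M) T \<and> x \<in> T \<and> T \<subseteq> N"
    using U(1) c(2) by blast
qed

text \<open>
  The preimage of the ordering class of \<open>F x\<close> is a union of strata and contains \<open>x\<close>, hence it contains the
  whole stratum of \<open>x\<close>.
\<close>
lemma stratum_ordering_equiv:
  assumes "weakly_stratified A \<S> (ordering_strata K) F" and \<S>: "partition_on A \<S>"
    and F: "F \<in> A \<rightarrow> real_functions K"
    and N: "N \<in> \<S>" and xy: "x \<in> N" "y \<in> N"
  shows "(F x, F y) \<in> ordering_equiv K"
proof -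
  have A: "x \<in> A" "y \<in> A"
    using \<S> N xy unfolding partition_on_def by blast+
  define T where "T = ordering_equiv K `` {F x}"
  have Fx: "F x \<in> real_functions K"
    using F A by blast
  have T: "T \<in> ordering_strata K"
    unfolding T_def ordering_strata_def using Fx by (rule quotientI)
  have "F x \<in> T"
    using Fx by (simp add: T_def ordering_equiv_def)
  obtain \<C> where C: "\<C> \<subseteq> \<S>" "{z \<in> A. F z \<in> T} = \<Union>\<C>"
    using assms(1) T unfolding weakly_stratified_def by blast
  then obtain N' where "N' \<in> \<C>" "x \<in> N'"
    using A \<open>F x \<in> T\<close> by blast
  moreover have "N' = N"
    using \<S> C(1) \<open>N' \<in> \<C>\<close> \<open>x \<in> N'\<close> N xy(1) unfolding partition_on_def disjoint_def by blast
  ultimately have "F y \<in> T"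
    using C(2) xy(2) by blast
  then show ?thesis
    by (simp add: T_def)
qed

text \<open>
  The simplices that give the coordinates of the barcode are the same at all points of \<open>N\<close>.  Evaluating at
  them the extension \<open>G\<close>, in place of \<open>F\<close>, yields coordinates that are smooth on all of \<open>U\<close>, although they
  describe the barcode only on \<open>U \<inter> N\<close>.
\<close>
theorem Dgm_smooth_lift_on_stratum:
  fixes K :: "'v set set" and p r :: nat and M :: "'a manifold" and F :: "'a \<Rightarrow> 'v set \<Rightarrow> real"
  assumes K: "abstract_simplicial_complex K" "finite K"
    and equiv: "\<And>x y. x \<in> N \<Longrightarrow> y \<in> N \<Longrightarrow> (F x, F y) \<in> ordering_equiv K"
    and filt: "\<And>x. x \<in> N \<Longrightarrow> filter_function K (F x)"
    and G: "Cr_map M r U K G" "\<And>x \<sigma>. x \<in> N \<inter> U \<Longrightarrow> \<sigma> \<in> K \<Longrightarrow> G x \<sigma> = F x \<sigma>"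
  shows "\<exists>m n B'. Cr_lift M r U m n B' \<and>
    (\<forall>x\<in>U \<inter> N. Dgm TYPE('k::field) p K (F x) = Q m n (B' x))"
proof -
  \<comment> \<open>For empty \<open>N\<close> the choice of \<open>f\<close> is arbitrary and the claim on barcodes is vacuous.\<close>
  define f where "f = F (SOME x. x \<in> N)"
  obtain ps us where pu: "set ps \<subseteq> K \<times> K" "set us \<subseteq> K"
    and Dgm: "\<And>g. (f, g) \<in> ordering_equiv K \<Longrightarrow> filter_function K g \<Longrightarrow>
       Dgm TYPE('k) p K g = Q (length ps) (length us)
         (\<lambda>k. if even k then g (fst (ps ! (k div 2))) else g (snd (ps ! (k div 2))), \<lambda>j. g (us ! j))"
    using Dgm_on_ordering_stratum[OF K, of f p, where ?'k = 'k] by blast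
  define h where "h k = (if even k then fst (ps ! (k div 2)) else snd (ps ! (k div 2)))" for k
  define B' where "B' x = (\<lambda>k. G x (h k), \<lambda>j. G x (us ! j))" for x
  have h: "h k \<in> K" if "k < 2 * length ps" for k
  proof -
    have "ps ! (k div 2) \<in> K \<times> K"
      using pu(1) that by (intro subsetD[OF pu(1)] nth_mem) auto
    then show ?thesis
      by (auto simp: h_def)
  qed
  have u: "us ! j \<in> K" if "j < length us" for j
    using pu(2) nth_mem[OF that] by blast
  have "Cr_lift M r U (length ps) (length us) B'"
    using Cr_map_reindex[OF G(1), of h "{..<2 * length ps}"]
      Cr_map_reindex[OF G(1), of "\<lambda>j. us ! j" "{..<length us}"] h u
    by (simp add: Cr_lift_def B'_def image_subset_iff)
  moreover have "Dgm TYPE('k) p K (F x) = Q (length ps) (length us) (B' x)" if x: "x \<in> U \<inter> N" for x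
  proof -
    have "(SOME x. x \<in> N) \<in> N"
      using x someI[of "\<lambda>x. x \<in> N" x] by blast
    then have "Dgm TYPE('k) p K (F x) = Q (length ps) (length us)
        (\<lambda>k. if even k then F x (fst (ps ! (k div 2))) else F x (snd (ps ! (k div 2))), \<lambda>j. F x (us ! j))"
      using x by (intro Dgm equiv filt) (auto simp: f_def intro: equiv)
    also have "\<dots> = Q (length ps) (length us) (\<lambda>k. F x (h k), \<lambda>j. F x (us ! j))"
      by (simp add: h_def if_distrib cong: if_cong)
    also have "\<dots> = Q (length ps) (length us) (B' x)"
    proof -
      have "image_mset (\<lambda>i. (F x (h (2 * i)), ereal (F x (h (2 * i + 1))))) (mset_set {..<length ps}) =
          image_mset (\<lambda>i. (G x (h (2 * i)), ereal (G x (h (2 * i + 1))))) (mset_set {..<length ps})"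
        using x h by (intro image_mset_cong) (simp add: G(2))
      moreover have "image_mset (\<lambda>j. (F x (us ! j), \<infinity>)) (mset_set {..<length us}) =
          image_mset (\<lambda>j. (G x (us ! j), \<infinity> :: ereal)) (mset_set {..<length us})"
        using x u by (intro image_mset_cong) (simp add: G(2))
      ultimately show ?thesis
        by (simp add: Q_def B'_def)
    qed
    finally show ?thesis .
  qed
  ultimately show ?thesis by blast
qed

theorem theorem4p19:
  fixes K :: "'v set set" and p r :: nat and M :: "'a manifold"
    and F :: "'a \<Rightarrow> 'v set \<Rightarrow> real" and \<S> :: "'a set set"
  assumes K: "abstract_simplicial_complex K" "finite K"
    and M: "smooth_manifold M"
    and F: "F \<in> topspace (mtop M) \<rightarrow> real_functions K"
    and filt: "\<And>\<theta>. \<theta> \<in> topspace (mtop M) \<Longrightarrow> filter_function K (F \<theta>)"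
    and S: "whitney_stratification M \<S>"
    and i: "weakly_stratified (topspace (mtop M)) \<S> (ordering_strata K) F"
    and ii: "\<And>N k. N \<in> \<S> \<Longrightarrow> submanifold M k N \<Longrightarrow> Cr_map_on_submanifold M k r N K F"
    and iii: "\<And>\<theta> N. \<theta> \<in> topspace (mtop M) \<Longrightarrow> N \<in> \<S> \<Longrightarrow> incident M N \<theta> \<Longrightarrow>
      \<exists>U G. openin (mtop M) U \<and> \<theta> \<in> U \<and> Cr_map M r U K G \<and>
            (\<forall>x\<in>N \<inter> U. \<forall>\<sigma>\<in>K. G x \<sigma> = F x \<sigma>)"
  shows "(\<forall>\<theta>\<in>topspace (mtop M). \<forall>N\<in>\<S>. incident M N \<theta> \<longrightarrow>
            r_differentiable_along M r (\<lambda>x. Dgm TYPE('k::field) p K (F x)) \<theta> N) \<and>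
         (\<forall>N\<in>\<S>. submanifold M (mdim M) N \<longrightarrow> (\<forall>\<theta>\<in>N.
            r_differentiable_at M r (\<lambda>x. Dgm TYPE('k) p K (F x)) \<theta>))"
proof -
  let ?X = "topspace (mtop M)"
  let ?B = "\<lambda>x. Dgm TYPE('k) p K (F x)"
  have part: "partition_on ?X \<S>"
    using S unfolding whitney_stratification_def by blast
  have N_sub: "N \<subseteq> ?X" if "N \<in> \<S>" for N
    using part that unfolding partition_on_def by blast
  have Bar: "?B \<in> ?X \<rightarrow> Bar"
  proof
    fix x assume x: "x \<in> ?X"
    then have "(F x, F x) \<in> ordering_equiv K"
      using F by (auto simp: ordering_equiv_def)
    then have "\<exists>m n uv. ?B x = Q m n uv"
      using Dgm_on_ordering_stratum[OF K, of "F x" p, where ?'k = 'k] filt[OF x] by blast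
    then show "?B x \<in> Bar"
      using Q_in_Bar by auto
  qed
  have lift: "\<exists>U m n B'. openin (mtop M) U \<and> \<theta> \<in> U \<and> Cr_lift M r U m n B' \<and>
      (\<forall>x\<in>U \<inter> N. ?B x = Q m n (B' x))"
    if \<theta>: "\<theta> \<in> ?X" and N: "N \<in> \<S>" and inc: "incident M N \<theta>" for \<theta> N
  proof -
    obtain U G where U: "openin (mtop M) U" "\<theta> \<in> U" and G: "Cr_map M r U K G"
      "\<forall>x\<in>N \<inter> U. \<forall>\<sigma>\<in>K. G x \<sigma> = F x \<sigma>"
      using iii[OF \<theta> N inc] by blast
    have "\<exists>m n B'. Cr_lift M r U m n B' \<and> (\<forall>x\<in>U \<inter> N. ?B x = Q m n (B' x))"
    proof (rule Dgm_smooth_lift_on_stratum[OF K _ _ G(1)])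
      show "(F x, F y) \<in> ordering_equiv K" if "x \<in> N" "y \<in> N" for x y
        using stratum_ordering_equiv[OF i part F N that] .
      show "filter_function K (F x)" if "x \<in> N" for x
        using filt N_sub[OF N] that by blast
    qed (use G(2) in blast)
    then show ?thesis
      using U by blast
  qed
  have "r_differentiable_along M r ?B \<theta> N"
    if "\<theta> \<in> ?X" "N \<in> \<S>" "incident M N \<theta>" for \<theta> N
    unfolding r_differentiable_along_def using Bar lift[OF that] by blast
  moreover have "r_differentiable_at M r ?B \<theta>"
    if N: "N \<in> \<S>" and top_dim: "submanifold M (mdim M) N" and \<theta>: "\<theta> \<in> N" for N \<theta>
  proof -
    have "\<theta> \<in> ?X" "incident M N \<theta>"
      using \<theta> N_sub[OF N] closure_of_subset[of N "mtop M"] by (auto simp: incident_def)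
    from lift[OF this(1) N this(2)]
    obtain U m n B' where U: "openin (mtop M) U" "\<theta> \<in> U" and B': "Cr_lift M r U m n B'"
      "\<forall>x\<in>U \<inter> N. ?B x = Q m n (B' x)"
      by (elim exE conjE)
    \<comment> \<open>Shrinking the neighbourhood to the open stratum removes the restriction to \<open>N\<close>.\<close>
    have "openin (mtop M) (U \<inter> N)" "\<theta> \<in> U \<inter> N"
      using U \<theta> top_dim_submanifold_open[OF top_dim] by auto
    moreover have "Cr_lift M r (U \<inter> N) m n B'"
      using B'(1) unfolding Cr_lift_def by (auto intro: Cr_map_subset)
    ultimately show ?thesis
      unfolding r_differentiable_at_def using Bar B'(2) by blast
  qed
  ultimately show ?thesis
    by blast
qed

end
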